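(* For $\varepsilon>0$, let $D_\varepsilon\subset\mathbb{C}^2$ be the domain \[ D_\varepsilon=\{(z,w)\in\mathbb{C}^2 : (\log|z|)^2+(\log|w|)^2<\varepsilon^2\}. \] Then $D_\varepsilon$ is a bounded strictly pseudoconvex domain, and its boundary $M_\varepsilon:=\partial D_\varepsilon\subset\mathbb{C}^2$ is a compact strictly pseudoconvex CR manifold (of real dimension 3) without umbilical points.
   Context: A point $p$ of a three-dimensional strictly pseudoconvex CR manifold (e.g. a strictly pseudoconvex real hypersurface in $\mathbb{C}^2$) is called (CR) umbilical if Cartan's sixth-order CR curvature tensor vanishes at $p$; equivalently, in Chern–Moser normal form $\operatorname{Im} w = |z|^2 + \sum_{k,l\ge 2} N_{kl}(\operatorname{Re} w)\, z^k\bar z^l$ centered at $p$, the coefficient $N_{24}(0)$ vanishes. A hypersurface is locally spherical near $p$ if and only if every point near $p$ is umbilical. *)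

theory Defs
  imports "HOL-Analysis.Analysis"
begin

definition cmul :: "complex \<Rightarrow> complex \<times> complex \<Rightarrow> complex \<times> complex" where
  "cmul c p = (c * fst p, c * snd p)"

definition holo2_on :: "(complex \<times> complex) set \<Rightarrow> (complex \<times> complex \<Rightarrow> complex \<times> complex) \<Rightarrow> bool" where
  "holo2_on U f \<longleftrightarrow> (\<forall>p\<in>U. \<exists>L. (f has_derivative L) (at p) \<and> (\<forall>c v. L (cmul c v) = cmul c (L v)))"

definition biholo :: "(complex \<times> complex) set \<Rightarrow> (complex \<times> complex \<Rightarrow> complex \<times> complex) \<Rightarrow> bool" where
  "biholo U f \<longleftrightarrow> open U \<and> holo2_on U f \<and> inj_on f U \<and> open (f ` U) \<and>
     holo2_on (f ` U) (the_inv_into U f)"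

definition C2_fun :: "(complex \<times> complex) set \<Rightarrow> (complex \<times> complex \<Rightarrow> real)
   \<Rightarrow> (complex \<times> complex \<Rightarrow> (complex \<times> complex) \<Rightarrow>\<^sub>L real)
   \<Rightarrow> (complex \<times> complex \<Rightarrow> (complex \<times> complex) \<Rightarrow>\<^sub>L ((complex \<times> complex) \<Rightarrow>\<^sub>L real)) \<Rightarrow> bool" where
  "C2_fun U \<rho> \<rho>1 \<rho>2 \<longleftrightarrow> open U \<and>
     (\<forall>q\<in>U. (\<rho> has_derivative blinfun_apply (\<rho>1 q)) (at q)) \<and>
     (\<forall>q\<in>U. (\<rho>1 has_derivative blinfun_apply (\<rho>2 q)) (at q)) \<and>
     continuous_on U \<rho>2"

text \<open>Levi form sum_{j,k} rho_{j kbar} t_j conj(t_k), written via the real Hessian: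
  it equals (D^2 rho(t,t) + D^2 rho(it,it)) / 4.\<close>
definition levi_form ::
  "(complex \<times> complex \<Rightarrow> (complex \<times> complex) \<Rightarrow>\<^sub>L ((complex \<times> complex) \<Rightarrow>\<^sub>L real))
    \<Rightarrow> complex \<times> complex \<Rightarrow> complex \<times> complex \<Rightarrow> real" where
  "levi_form \<rho>2 q t = (blinfun_apply (blinfun_apply (\<rho>2 q) t) t
      + blinfun_apply (blinfun_apply (\<rho>2 q) (cmul \<i> t)) (cmul \<i> t)) / 4"

text \<open>d rho(q) <> 0 and the Levi form is positive definite on the complex tangent space
  H_q = {t. d rho(q) t = 0 and d rho(q)(i t) = 0} (i.e. sum_j rho_j(q) t_j = 0).\<close>
definition levi_pos_at ::
  "(complex \<times> complex \<Rightarrow> (complex \<times> complex) \<Rightarrow>\<^sub>L real)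
   \<Rightarrow> (complex \<times> complex \<Rightarrow> (complex \<times> complex) \<Rightarrow>\<^sub>L ((complex \<times> complex) \<Rightarrow>\<^sub>L real))
   \<Rightarrow> complex \<times> complex \<Rightarrow> bool" where
  "levi_pos_at \<rho>1 \<rho>2 q \<longleftrightarrow> \<rho>1 q \<noteq> 0 \<and>
     (\<forall>t. t \<noteq> 0 \<and> blinfun_apply (\<rho>1 q) t = 0 \<and> blinfun_apply (\<rho>1 q) (cmul \<i> t) = 0
          \<longrightarrow> levi_form \<rho>2 q t > 0)"

definition spsc_domain :: "(complex \<times> complex) set \<Rightarrow> bool" where
  "spsc_domain D \<longleftrightarrow> open D \<and> connected D \<and> D \<noteq> {} \<and>
     (\<exists>U \<rho> \<rho>1 \<rho>2. C2_fun U \<rho> \<rho>1 \<rho>2 \<and> frontier D \<subseteq> U \<and>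
        D \<inter> U = {q\<in>U. \<rho> q < 0} \<and> (\<forall>q\<in>frontier D. levi_pos_at \<rho>1 \<rho>2 q))"

text \<open>Strictly pseudoconvex (C^2) real hypersurface of C^2 (a 3-dimensional strictly
  pseudoconvex CR manifold with the induced CR structure).\<close>
definition spsc_hypersurface :: "(complex \<times> complex) set \<Rightarrow> bool" where
  "spsc_hypersurface M \<longleftrightarrow> (\<forall>p\<in>M. \<exists>U \<rho> \<rho>1 \<rho>2. C2_fun U \<rho> \<rho>1 \<rho>2 \<and> p \<in> U \<and>
        M \<inter> U = {q\<in>U. \<rho> q = 0} \<and> (\<forall>q\<in>M \<inter> U. levi_pos_at \<rho>1 \<rho>2 q))"

text \<open>Umbilical point via Chern--Moser normal form: there is a local biholomorphism
  Phi near p with Phi p = 0 carrying M onto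
  Im w = |z|^2 + sum_{k,l>=2} N_kl(Re w) z^k zbar^l,
  with N_lk = conj N_kl and the normalization N_22 = N_23 = N_33 = 0 (dimension 2),
  and N_24(0) = 0.\<close>
definition umbilical :: "(complex \<times> complex) set \<Rightarrow> complex \<times> complex \<Rightarrow> bool" where
  "umbilical M p \<longleftrightarrow>
    (\<exists>U \<Phi> (N :: nat \<Rightarrow> nat \<Rightarrow> real \<Rightarrow> complex).
       p \<in> U \<and> biholo U \<Phi> \<and> \<Phi> p = (0, 0) \<and>
       (\<forall>k l u. (k < 2 \<or> l < 2) \<longrightarrow> N k l u = 0) \<and>
       (\<forall>k l u. N l k u = cnj (N k l u)) \<and>
       (\<forall>u. N 2 2 u = 0 \<and> N 2 3 u = 0 \<and> N 3 3 u = 0) \<and>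
       (\<forall>z w. (z, w) \<in> \<Phi> ` U \<longrightarrow>
          (\<lambda>(k, l). norm (N k l (Re w) * z ^ k * cnj z ^ l)) summable_on UNIV) \<and>
       \<Phi> ` (M \<inter> U) = {(z, w). (z, w) \<in> \<Phi> ` U \<and>
          Im w = (cmod z)\<^sup>2 + Re (infsum (\<lambda>(k, l). N k l (Re w) * z ^ k * cnj z ^ l) UNIV)} \<and>
       N 2 4 0 = 0)"

text \<open>The domain D_eps (log|z| is -infinity at 0, so the axes are excluded).\<close>
definition Deps :: "real \<Rightarrow> (complex \<times> complex) set" where
  "Deps \<epsilon> = {(z, w). z \<noteq> 0 \<and> w \<noteq> 0 \<and> (ln (cmod z))\<^sup>2 + (ln (cmod w))\<^sup>2 < \<epsilon>\<^sup>2}"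

end

theory Submission
  imports Defs "HOL-Complex_Analysis.Complex_Analysis"
begin

text \<open>
  In the logarithmic coordinates \<open>x = log z\<close>, \<open>y = log w\<close> the boundary is the tube over a circle,
  \<open>(Re x)\<^sup>2 + (Re y)\<^sup>2 = \<epsilon>\<^sup>2\<close>, so its Segre varieties are the complex circles of radius \<open>2 \<epsilon>\<close>.
  In a Chern--Moser normal form the Segre varieties through the origin are
  \<open>w = 2 \<i> \<zeta> z + 2 \<i> n(\<zeta>) z\<^sup>2 + O(z\<^sup>3)\<close> with \<open>n(\<zeta>) = \<Sum>\<^sub>l N\<^sub>2\<^sub>l(0) \<zeta>\<^sup>l\<close>, and \<open>n(\<zeta>) = O(\<zeta>\<^sup>5)\<close> at an
  umbilical point. Transporting these 2-jets by the inverse of the normalizing map and imposing the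
  curvature equation of the circles gives \<open>16 \<epsilon>\<^sup>2 q(\<zeta>)\<^sup>2 = Q(\<zeta>)\<^sup>3 + O(\<zeta>\<^sup>5)\<close> with a cubic polynomial
  \<open>q\<close> and a quadratic polynomial \<open>Q\<close>, \<open>Q(0) \<noteq> 0\<close>. (This is Tresse's invariant: a second order
  equation \<open>y'' = F(x, y, y')\<close> that is flat to this order has \<open>F\<close> cubic in \<open>y'\<close>, whereas the circles
  have \<open>F = c (1 + y'\<^sup>2)\<^bsup>3/2\<^esup>\<close>.) Comparing the coefficients up to \<open>\<zeta>\<^sup>4\<close> shows that the discriminant
  of \<open>Q\<close> vanishes; but that discriminant is a nonzero multiple of the squared Jacobian determinant
  of the normalizing map.

  The coefficients \<open>N\<^sub>k\<^sub>l\<close> are arbitrary functions of \<open>u = Re w\<close>, possibly discontinuous. Therefore the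
  equation of the hypersurface is polarized in \<open>(z, \<zeta>)\<close> for each fixed real \<open>u\<close>, and only identities
  between functions that are visibly holomorphic in \<open>u\<close> are continued to complex \<open>u\<close>.
\<close>

section \<open>Second order Taylor polynomials\<close>

text \<open>Cauchy's inequalities bound the \<open>i\<close>-th term by
  \<open>B * (norm z / r) ^ i\<close>; for \<open>norm z \<le> r / 2\<close> the tail is geometric
  with ratio at most 1/2, whence the factor 2. The constant depends on \<open>f\<close> only through
  \<open>B\<close>, so the slices of a function of two variables get one common error bound.\<close>

lemma holomorphic_taylor_bound:
  assumes f: "f holomorphic_on ball 0 R" and r: "0 < r" "r < R"
    and B: "\<And>x. norm x \<le> r \<Longrightarrow> norm (f x) \<le> B" and z: "norm z \<le> r / 2"
  shows "norm (f z - (\<Sum>i<n. (deriv ^^ i) f 0 / fact i * z ^ i)) \<le> 2 * B * (norm z / r) ^ n"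
proof -
  let ?a = "\<lambda>i. (deriv ^^ i) f 0 / fact i * z ^ i"
  have fr: "f holomorphic_on ball 0 r" "continuous_on (cball 0 r) f"
    using r by (auto intro!: holomorphic_on_imp_continuous_on holomorphic_on_subset[OF f])
  have B0: "0 \<le> B" using B[of 0] r norm_ge_zero[of "f 0"] by (simp del: norm_ge_zero)
  have zr: "norm z / r \<le> 1 / 2" using z r by (simp add: field_simps)
  have a: "norm (?a i) \<le> B * (norm z / r) ^ i" for i
  proof -
    have "norm ((deriv ^^ i) f 0) \<le> fact i * B / r ^ i"
      by (rule Cauchy_inequality[OF fr r(1)]) (use B in auto)
    then have "norm ((deriv ^^ i) f 0) / fact i * norm z ^ i \<le> (fact i * B / r ^ i) / fact i * norm z ^ i"
      by (intro mult_right_mono divide_right_mono) auto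
    then show ?thesis by (simp add: norm_mult norm_divide norm_power power_divide)
  qed
  have "?a sums f z"
    using holomorphic_power_series[OF fr(1), of z] z r by (auto simp: dist_norm)
  then have s: "(\<lambda>i. ?a (i + n)) sums (f z - (\<Sum>i<n. ?a i))"
    by (rule sums_split_initial_segment)
  have "(\<lambda>i. B * (norm z / r) ^ n * (norm z / r) ^ i) sums (B * (norm z / r) ^ n * (1 / (1 - norm z / r)))"
    using zr r by (intro sums_mult geometric_sums) auto
  then have s': "(\<lambda>i. B * (norm z / r) ^ (i + n)) sums (B * (norm z / r) ^ n * (1 / (1 - norm z / r)))"
    by (simp add: power_add mult_ac)
  have "norm (f z - (\<Sum>i<n. ?a i)) \<le> B * (norm z / r) ^ n * (1 / (1 - norm z / r))"
    using norm_suminf_le[of "\<lambda>i. ?a (i + n)" "\<lambda>i. B * (norm z / r) ^ (i + n)"] a s s'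
    by (simp add: sums_iff)
  also have "\<dots> \<le> B * (norm z / r) ^ n * 2"
    using zr B0 r by (intro mult_left_mono) (auto simp: divide_le_eq)
  finally show ?thesis by (simp add: mult_ac)
qed

text \<open>A 2-jet as a growth condition, so that sums, products and compositions can be expanded
  without computing iterated derivatives. The filter \<open>nhds 0\<close> sees the point 0 itself,
  which forces \<open>a = f 0\<close>.\<close>

definition taylor2 :: "(complex \<Rightarrow> complex) \<Rightarrow> complex \<Rightarrow> complex \<Rightarrow> complex \<Rightarrow> bool" where
  "taylor2 f a b c \<longleftrightarrow> (\<lambda>z. f z - (a + b * z + c * z\<^sup>2)) \<in> O[nhds 0](\<lambda>z. z ^ 3)"

lemma bigo_one_nhds: "isCont f 0 \<Longrightarrow> f \<in> O[nhds (0::complex)](\<lambda>_. 1::complex)"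
  by (rule bigoI_tendsto[of _ _ "f 0"])
     (auto simp: isCont_def tendsto_at_iff_tendsto_nhds)

lemma taylor2_const [intro]: "taylor2 (\<lambda>_. a) a 0 0"
  by (simp add: taylor2_def)

lemma taylor2_id: "taylor2 (\<lambda>z. z) 0 1 0"
  by (simp add: taylor2_def)

lemma taylor2_add:
  assumes "taylor2 f a b c" "taylor2 g a' b' c'"
  shows "taylor2 (\<lambda>z. f z + g z) (a + a') (b + b') (c + c')"
proof -
  have "(\<lambda>z. f z + g z - (a + a' + (b + b') * z + (c + c') * z\<^sup>2))
      = (\<lambda>z. (f z - (a + b * z + c * z\<^sup>2)) + (g z - (a' + b' * z + c' * z\<^sup>2)))"
    by (simp add: algebra_simps)
  then show ?thesis using assms unfolding taylor2_def by (simp add: sum_in_bigo)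
qed

lemma taylor2_bigo_1: assumes "taylor2 f a b c" shows "f \<in> O[nhds 0](\<lambda>_. 1)"
proof -
  have "(\<lambda>z::complex. z ^ 3) \<in> O[nhds 0](\<lambda>_. 1 :: complex)"
    by (intro bigo_one_nhds continuous_intros)
  with assms have "(\<lambda>z. f z - (a + b * z + c * z\<^sup>2)) \<in> O[nhds 0](\<lambda>_. 1)"
    unfolding taylor2_def by (rule landau_o.big_trans)
  moreover have "(\<lambda>z. a + b * z + c * z\<^sup>2) \<in> O[nhds 0](\<lambda>_. 1)"
    by (intro bigo_one_nhds continuous_intros)
  ultimately have "(\<lambda>z. (f z - (a + b * z + c * z\<^sup>2)) + (a + b * z + c * z\<^sup>2)) \<in> O[nhds 0](\<lambda>_. 1)"
    by (rule sum_in_bigo)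
  then show ?thesis by simp
qed

lemma taylor2_mult:
  assumes "taylor2 f a b c" "taylor2 g a' b' c'"
  shows "taylor2 (\<lambda>z. f z * g z) (a * a') (a * b' + b * a') (a * c' + b * b' + c * a')"
proof -
  have 1: "(\<lambda>z. (f z - (a + b * z + c * z\<^sup>2)) * g z) \<in> O[nhds 0](\<lambda>z. z ^ 3 * 1)"
    using assms(1) taylor2_bigo_1[OF assms(2)] unfolding taylor2_def by (rule landau_o.big.mult)
  have 2: "(\<lambda>z. (g z - (a' + b' * z + c' * z\<^sup>2)) * (a + b * z + c * z\<^sup>2)) \<in> O[nhds 0](\<lambda>z. z ^ 3 * 1)"
    using assms(2) unfolding taylor2_def
    by (rule landau_o.big.mult) (intro bigo_one_nhds continuous_intros)
  have 3: "(\<lambda>z. z ^ 3 * (b * c' + c * b' + c * c' * z)) \<in> O[nhds 0](\<lambda>z. z ^ 3 * 1)"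
    by (rule landau_o.big.mult) (simp, intro bigo_one_nhds continuous_intros)
  have "(\<lambda>z. f z * g z - (a * a' + (a * b' + b * a') * z + (a * c' + b * b' + c * a') * z\<^sup>2))
      = (\<lambda>z. ((f z - (a + b * z + c * z\<^sup>2)) * g z
          + (g z - (a' + b' * z + c' * z\<^sup>2)) * (a + b * z + c * z\<^sup>2))
          + z ^ 3 * (b * c' + c * b' + c * c' * z))"
    by (intro ext) (simp add: algebra_simps power2_eq_square power3_eq_cube)
  then show ?thesis unfolding taylor2_def using sum_in_bigo(1)[OF sum_in_bigo(1)[OF 1 2] 3] by simp
qed

lemma taylor2_cong_bigo:
  assumes "taylor2 f a b c" "(\<lambda>z. g z - f z) \<in> O[nhds 0](\<lambda>z. z ^ 3)"
  shows "taylor2 g a b c"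
proof -
  have "(\<lambda>z. g z - (a + b * z + c * z\<^sup>2)) = (\<lambda>z. (g z - f z) + (f z - (a + b * z + c * z\<^sup>2)))"
    by (simp add: algebra_simps)
  then show ?thesis using sum_in_bigo(1)[OF assms(2) assms(1)[unfolded taylor2_def]]
    unfolding taylor2_def by simp
qed

text \<open>Uniqueness of 2-jets: evaluation at 0 gives \<open>a\<close>; then the estimate is
  divided by \<open>z\<close> and a limit taken, twice. In this way an identity near 0 becomes three
  equations between coefficients.\<close>

lemma taylor2_zero:
  assumes "taylor2 f a b c" "eventually (\<lambda>z. f z = 0) (nhds 0)"
  shows "a = 0" "b = 0" "c = 0"
proof -
  have "(\<lambda>z. a + b * z + c * z\<^sup>2) \<in> O[nhds 0](\<lambda>z. z ^ 3)"
  proof -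
    have "(\<lambda>z. - (a + b * z + c * z\<^sup>2)) \<in> O[nhds 0](\<lambda>z. z ^ 3)"
      by (rule landau_o.big.in_cong[THEN iffD1, OF _ assms(1)[unfolded taylor2_def]])
         (use assms(2) in eventually_elim, auto)
    then show ?thesis by (simp only: landau_o.big.uminus_in_iff)
  qed
  then obtain C where C: "C > 0" "eventually (\<lambda>z. norm (a + b * z + c * z\<^sup>2) \<le> C * norm (z ^ 3)) (nhds 0)"
    by (elim landau_o.bigE)
  have a: "a = 0"
    using eventually_nhds_x_imp_x[OF C(2)] by simp
  have evb: "eventually (\<lambda>z. norm (b + c * z) \<le> C * norm z ^ 2) (at 0)"
    using C(2) unfolding eventually_at_filter
  proof eventually_elim
    case (elim z)
    have "norm z * norm (b + c * z) \<le> norm z * (C * norm z ^ 2)" if "z \<noteq> 0"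
      using elim a by (simp add: power2_eq_square power3_eq_cube norm_mult algebra_simps flip: norm_mult)
    then show ?case by auto
  qed
  have "b = 0"
  proof -
    have "((\<lambda>z. b + c * z) \<longlongrightarrow> 0) (at 0)"
      by (rule Lim_null_comparison[OF evb]) (auto intro!: tendsto_eq_intros)
    moreover have "((\<lambda>z. b + c * z) \<longlongrightarrow> b) (at 0)" by (auto intro!: tendsto_eq_intros)
    ultimately show ?thesis using LIM_unique by blast
  qed
  have "eventually (\<lambda>z. norm c \<le> C * norm z) (at (0::complex))"
    using evb eventually_neq_at_within[of 0 0]
  proof eventually_elim
    case (elim z)
    then show ?case using \<open>b = 0\<close>
      by (simp add: power2_eq_square norm_mult)
  qed
  then have "((\<lambda>z. c) \<longlongrightarrow> 0) (at (0::complex))"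
    by (rule Lim_null_comparison) (auto intro!: tendsto_eq_intros)
  then have "c = 0" using LIM_unique tendsto_const by blast
  then show "a = 0" "b = 0" "c = 0" using a \<open>b = 0\<close> by auto
qed

lemma taylor2_tendsto: assumes "taylor2 f a b c" shows "(f \<longlongrightarrow> a) (nhds 0)"
proof -
  have z3: "((\<lambda>z::complex. z ^ 3) \<longlongrightarrow> 0) (nhds 0)"
    by (auto intro!: tendsto_eq_intros filterlim_ident)
  from assms obtain C where "eventually (\<lambda>z. norm (f z - (a + b * z + c * z\<^sup>2)) \<le> C * norm (z ^ 3)) (nhds 0)"
    unfolding taylor2_def by (elim landau_o.bigE)
  then have "((\<lambda>z. f z - (a + b * z + c * z\<^sup>2)) \<longlongrightarrow> 0) (nhds 0)"
    by (rule Lim_null_comparison) (auto intro!: tendsto_eq_intros filterlim_ident)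
  moreover have "((\<lambda>z. a + b * z + c * z\<^sup>2) \<longlongrightarrow> a) (nhds 0)"
    by (auto intro!: tendsto_eq_intros filterlim_ident)
  ultimately have "((\<lambda>z. (f z - (a + b * z + c * z\<^sup>2)) + (a + b * z + c * z\<^sup>2)) \<longlongrightarrow> 0 + a) (nhds 0)"
    by (rule tendsto_add)
  then show ?thesis by simp
qed

lemma taylor2_holomorphic:
  assumes "f holomorphic_on ball 0 R" "R > 0"
  shows "taylor2 f (f 0) (deriv f 0) (deriv (deriv f) 0 / 2)"
proof -
  define r where "r = R / 2"
  have r: "0 < r" "r < R" using assms by (auto simp: r_def)
  have "continuous_on (cball 0 r) f"
    using r by (auto intro!: holomorphic_on_imp_continuous_on holomorphic_on_subset[OF assms(1)])
  then have "bounded (f ` cball 0 r)" by (intro compact_imp_bounded compact_continuous_image) auto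
  then obtain B where B: "\<And>x. norm x \<le> r \<Longrightarrow> norm (f x) \<le> B"
    by (fastforce simp: bounded_iff)
  have "eventually (\<lambda>z. z \<in> ball 0 (r/2)) (nhds (0::complex))"
    using r by (intro eventually_nhds_in_open) auto
  then have "eventually (\<lambda>z. norm (f z - (f 0 + deriv f 0 * z + deriv (deriv f) 0 / 2 * z\<^sup>2))
     \<le> 2 * B / r ^ 3 * norm (z ^ 3)) (nhds 0)"
  proof eventually_elim
    case (elim z)
    then show ?case using holomorphic_taylor_bound[OF assms(1) r B, of z 3]
      by (simp add: eval_nat_numeral norm_mult norm_power norm_divide power_divide field_simps)
  qed
  then show ?thesis unfolding taylor2_def by (rule bigoI)
qed

text \<open>With \<open>q = w - u = O(z)\<close> the cubic remainder of \<open>g\<close> at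
  \<open>u\<close> becomes \<open>O(z ^ 3)\<close>, so only the quadratic Taylor polynomial of
  \<open>g\<close> has to be expanded.\<close>

lemma taylor2_compose:
  assumes w: "taylor2 w u w1 w2" and g: "g holomorphic_on ball u R" "R > 0"
  shows "taylor2 (\<lambda>z. g (w z)) (g u) (deriv g u * w1) (deriv g u * w2 + deriv (deriv g) u / 2 * w1\<^sup>2)"
proof -
  let ?h = "\<lambda>t. g (u + t)"
  have h: "?h holomorphic_on ball 0 R"
    by (rule holomorphic_on_compose_gen[OF _ g(1), unfolded o_def])
       (auto intro!: holomorphic_intros simp: dist_norm)
  have d1: "deriv ?h t = deriv g (u + t)" if "t \<in> ball 0 R" for t
  proof -
    have "(g has_field_derivative deriv g (u + t)) (at (u + t))"
      using that by (intro holomorphic_derivI[OF g(1)]) (auto simp: dist_norm)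
    then have "(?h has_field_derivative deriv g (u + t)) (at t)"
      using DERIV_shift[of g "deriv g (u+t)" t u] by (simp add: add.commute)
    then show ?thesis by (rule DERIV_imp_deriv)
  qed
  have d2: "deriv (deriv ?h) 0 = deriv (deriv g) u"
  proof -
    have "deriv (deriv ?h) 0 = deriv (\<lambda>t. deriv g (u + t)) 0"
      by (rule deriv_cong_ev) (use g(2) d1 in \<open>auto intro!: eventually_nhds_in_open
          intro: eventually_mono[of "\<lambda>t. t \<in> ball 0 R"]\<close>)
    also have "(deriv g has_field_derivative deriv (deriv g) u) (at u)"
      using g by (intro holomorphic_derivI[of _ "ball u R"] holomorphic_deriv) auto
    then have "((\<lambda>t. deriv g (u + t)) has_field_derivative deriv (deriv g) u) (at 0)"
      using DERIV_shift[of "deriv g" "deriv (deriv g) u" 0 u] by (simp add: add.commute)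
    then have "deriv (\<lambda>t. deriv g (u + t)) 0 = deriv (deriv g) u" by (rule DERIV_imp_deriv)
    finally show ?thesis .
  qed
  have T: "taylor2 ?h (g u) (deriv g u) (deriv (deriv g) u / 2)"
    using taylor2_holomorphic[OF h g(2)] d1[of 0] d2 g(2) by simp
  define q where "q = (\<lambda>z. w z - u)"
  have q: "taylor2 q 0 w1 w2"
    using taylor2_add[OF w taylor2_const[of "-u"]] by (simp add: q_def)
  have q1: "q \<in> O[nhds 0](\<lambda>z. z)"
  proof -
    have "(\<lambda>z. q z - (0 + w1 * z + w2 * z\<^sup>2)) \<in> O[nhds 0](\<lambda>z. z * z ^ 2)"
      using q by (simp add: taylor2_def power3_eq_cube power2_eq_square mult.assoc)
    also have "(\<lambda>z::complex. z * z ^ 2) \<in> O[nhds 0](\<lambda>z. z * 1)"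
      by (intro landau_o.big.mult bigo_one_nhds continuous_intros) simp
    finally have a: "(\<lambda>z. q z - (0 + w1 * z + w2 * z\<^sup>2)) \<in> O[nhds 0](\<lambda>z. z)" by simp
    have b: "(\<lambda>z. z * (w1 + w2 * z)) \<in> O[nhds 0](\<lambda>z. z * 1)"
      by (intro landau_o.big.mult bigo_one_nhds continuous_intros) simp
    show ?thesis using sum_in_bigo(1)[OF a b[unfolded mult_1_right]] by (simp add: algebra_simps power2_eq_square)
  qed
  have lim: "filterlim q (nhds 0) (nhds 0)" by (rule taylor2_tendsto[OF q])
  have "(\<lambda>z. ?h (q z) - (g u + deriv g u * q z + deriv (deriv g) u / 2 * (q z)\<^sup>2)) \<in> O[nhds 0](\<lambda>z. q z ^ 3)"
    using landau_o.big.compose[OF T[unfolded taylor2_def] lim] .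
  also have "(\<lambda>z. q z ^ 3) \<in> O[nhds 0](\<lambda>z. z ^ 3)"
    using q1 by (rule landau_o.big_power)
  finally have *: "(\<lambda>z. g (w z) - (g u + deriv g u * q z + deriv (deriv g) u / 2 * (q z * q z))) \<in> O[nhds 0](\<lambda>z. z ^ 3)"
    by (simp add: q_def power2_eq_square)
  have "taylor2 (\<lambda>z. g u + deriv g u * q z + deriv (deriv g) u / 2 * (q z * q z)) (g u) (deriv g u * w1)
     (deriv g u * w2 + deriv (deriv g) u / 2 * w1\<^sup>2)"
    using taylor2_add[OF taylor2_add[OF taylor2_const[of "g u"] taylor2_mult[OF taylor2_const[of "deriv g u"] q]]
      taylor2_mult[OF taylor2_const[of "deriv (deriv g) u / 2"] taylor2_mult[OF q q]]]
    by (simp add: power2_eq_square)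
  then show ?thesis by (rule taylor2_cong_bigo) (rule *)
qed

section \<open>Functions of two complex variables\<close>

text \<open>Holomorphy on a bidisc, stated through a complex-linear total derivative at each point.
  This matches \<open>holo2_on\<close> for a single component, and holomorphy in one variable
  follows by restriction to holomorphic curves.\<close>

definition hol2 :: "real \<Rightarrow> (complex \<times> complex \<Rightarrow> complex) \<Rightarrow> bool" where
  "hol2 r f \<longleftrightarrow> (\<forall>z w. norm z < r \<longrightarrow> norm w < r \<longrightarrow>
     (\<exists>a b. (f has_derivative (\<lambda>v. a * fst v + b * snd v)) (at (z, w))))"

lemma hol2_curve:
  assumes f: "hol2 r f" and S: "open S" and p: "p holomorphic_on S" and q: "q holomorphic_on S"
    and le: "\<And>t. t \<in> S \<Longrightarrow> norm (p t) < r" "\<And>t. t \<in> S \<Longrightarrow> norm (q t) < r"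
  shows "(\<lambda>t. f (p t, q t)) holomorphic_on S"
  unfolding holomorphic_on_open[OF S]
proof
  fix t assume t: "t \<in> S"
  obtain a b where ab: "(f has_derivative (\<lambda>v. a * fst v + b * snd v)) (at (p t, q t))"
    using f le t unfolding hol2_def by blast
  have dp: "(p has_derivative (\<lambda>h. deriv p t * h)) (at t)" "(q has_derivative (\<lambda>h. deriv q t * h)) (at t)"
    using holomorphic_derivI[OF p S t] holomorphic_derivI[OF q S t] by (auto simp: has_field_derivative_def)
  have "((\<lambda>t. f (p t, q t)) has_derivative (\<lambda>h. a * fst (deriv p t * h, deriv q t * h) + b * snd (deriv p t * h, deriv q t * h))) (at t)"
    by (rule has_derivative_compose[OF has_derivative_Pair[OF dp] ab])
  then have "((\<lambda>t. f (p t, q t)) has_field_derivative (a * deriv p t + b * deriv q t)) (at t)"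
    unfolding has_field_derivative_def by (rule has_derivative_eq_rhs) (auto simp: algebra_simps)
  then show "\<exists>f'. ((\<lambda>t. f (p t, q t)) has_field_derivative f') (at t)" by blast
qed

lemma hol2_continuous_on:
  assumes "hol2 r f"
  shows "continuous_on {x. norm (fst x) < r \<and> norm (snd x) < r} f"
proof (rule continuous_at_imp_continuous_on, safe)
  fix a b :: complex assume "norm (fst (a, b)) < r" "norm (snd (a, b)) < r"
  then show "isCont f (a, b)"
    using assms has_derivative_continuous unfolding hol2_def by fastforce
qed

lemma hol2_cnj:
  assumes "hol2 r f"
  shows "hol2 r (\<lambda>x. cnj (f (cnj (fst x), cnj (snd x))) + c)"
  unfolding hol2_def
proof (intro allI impI)
  fix z w :: complex assume zw: "norm z < r" "norm w < r"
  then obtain a b where ab: "(f has_derivative (\<lambda>v. a * fst v + b * snd v)) (at (cnj z, cnj w))"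
    using assms unfolding hol2_def by (metis complex_mod_cnj)
  have 1: "((\<lambda>x. (cnj (fst x), cnj (snd x))) has_derivative (\<lambda>v. (cnj (fst v), cnj (snd v)))) (at (z, w))"
    by (intro has_derivative_Pair has_derivative_cnj has_derivative_fst has_derivative_snd has_derivative_ident)
  have "((\<lambda>x. f (cnj (fst x), cnj (snd x))) has_derivative (\<lambda>v. a * cnj (fst v) + b * cnj (snd v))) (at (z, w))"
    using has_derivative_compose[OF 1, of f "\<lambda>v. a * fst v + b * snd v"] ab by simp
  then have "((\<lambda>x. cnj (f (cnj (fst x), cnj (snd x))) + c) has_derivative (\<lambda>v. cnj (a * cnj (fst v) + b * cnj (snd v)) + 0)) (at (z, w))"
    by (intro has_derivative_add has_derivative_cnj has_derivative_const)
  then have "((\<lambda>x. cnj (f (cnj (fst x), cnj (snd x))) + c) has_derivative (\<lambda>v. cnj a * fst v + cnj b * snd v)) (at (z, w))"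
    by simp
  then show "\<exists>a b. ((\<lambda>x. cnj (f (cnj (fst x), cnj (snd x))) + c) has_derivative (\<lambda>v. a * fst v + b * snd v)) (at (z, w))"
    by blast
qed

text \<open>The error \<open>C * norm h\<close> is uniform on \<open>S\<close>, so \<open>g\<close>
  is a locally uniform limit of the holomorphic \<open>G h\<close>. Applied to difference quotients,
  this shows that Taylor coefficients in one variable are holomorphic in the other.\<close>

lemma holomorphic_of_linear_rate:
  assumes S: "open S" and d: "d > 0"
    and G: "\<And>h. h \<noteq> 0 \<Longrightarrow> norm h < d \<Longrightarrow> G h holomorphic_on S"
    and rate: "\<And>h w. h \<noteq> 0 \<Longrightarrow> norm h < d \<Longrightarrow> w \<in> S \<Longrightarrow> norm (G h w - g w) \<le> C * norm (h::complex)"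
  shows "g holomorphic_on S"
  unfolding holomorphic_on_open[OF S]
proof
  fix x assume "x \<in> S"
  then obtain e where e: "e > 0" "cball x e \<subseteq> S" using S open_contains_cball by blast
  have ev: "eventually (\<lambda>h. h \<noteq> 0 \<and> norm h < d) (at 0)"
    using d by (auto simp: eventually_at intro!: exI[of _ d])
  have "uniform_limit (cball x e) G g (at 0)"
  proof (rule uniform_limitI)
    fix \<epsilon> :: real assume "\<epsilon> > 0"
    have "((\<lambda>h::complex. C * norm h) \<longlongrightarrow> 0) (at 0)" by (auto intro!: tendsto_eq_intros)
    then have "eventually (\<lambda>h::complex. C * norm h < \<epsilon>) (at 0)"
      using \<open>\<epsilon> > 0\<close> order_tendstoD(2) by blast
    with ev show "\<forall>\<^sub>F h in at 0. \<forall>w\<in>cball x e. dist (G h w) (g w) < \<epsilon>"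
    proof eventually_elim
      case (elim h)
      show ?case
      proof
        fix w assume "w \<in> cball x e"
        then have "norm (G h w - g w) \<le> C * norm h" using elim e rate by blast
        then show "dist (G h w) (g w) < \<epsilon>" using elim by (simp add: dist_norm)
      qed
    qed
  qed
  moreover have "\<forall>\<^sub>F h in at 0. continuous_on (cball x e) (G h) \<and> G h holomorphic_on ball x e"
    using ev
  proof eventually_elim
    case (elim h)
    then have "G h holomorphic_on cball x e" using G e holomorphic_on_subset by blast
    then show ?case
      by (meson ball_subset_cball holomorphic_on_imp_continuous_on holomorphic_on_subset)
  qed
  ultimately have "g holomorphic_on ball x e"
    using holomorphic_uniform_limit[of x e G "at 0" g] by auto
  then show "\<exists>f'. (g has_field_derivative f') (at x)"
    using e holomorphic_derivI[of g "ball x e" x] by auto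
qed

text \<open>On the smaller closed bidisc \<open>f\<close> is bounded, so the Taylor remainder in
  \<open>z\<close> is uniform in \<open>w\<close>. The coefficients \<open>f1\<close>,
  \<open>f2\<close> are then limits, at a linear rate, of quotients that are holomorphic in
  \<open>w\<close>.\<close>

lemma hol2_taylor:
  assumes f: "hol2 r f" and r: "0 < r"
  obtains f1 f2 C where "f1 holomorphic_on ball 0 (r / 2)" "f2 holomorphic_on ball 0 (r / 2)"
    "\<And>w. f1 w = deriv (\<lambda>z. f (z, w)) 0"
    "\<And>z w. norm z \<le> r / 4 \<Longrightarrow> norm w < r / 2 \<Longrightarrow>
       norm (f (z, w) - (f (0, w) + f1 w * z + f2 w * z\<^sup>2)) \<le> C * norm z ^ 3"
proof -
  define \<rho> where "\<rho> = r / 2"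
  have \<rho>: "0 < \<rho>" "\<rho> < r" using r by (auto simp: \<rho>_def)
  have "continuous_on (cball 0 \<rho> \<times> cball 0 \<rho>) f"
    by (rule continuous_on_subset[OF hol2_continuous_on[OF f]]) (use \<rho> in auto)
  then have "bounded (f ` (cball 0 \<rho> \<times> cball 0 \<rho>))"
    by (intro compact_imp_bounded compact_continuous_image compact_Times) auto
  then obtain B where B: "\<And>z w. norm z \<le> \<rho> \<Longrightarrow> norm w \<le> \<rho> \<Longrightarrow> norm (f (z, w)) \<le> B"
    by (fastforce simp: bounded_iff)
  define f1 where "f1 = (\<lambda>w. deriv (\<lambda>z. f (z, w)) 0)"
  define f2 where "f2 = (\<lambda>w. deriv (deriv (\<lambda>z. f (z, w))) 0 / 2)"
  have hz: "(\<lambda>z. f (z, w)) holomorphic_on ball 0 r" if "norm w < r" for w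
    by (rule hol2_curve[OF f]) (use that in \<open>auto intro!: holomorphic_intros\<close>)
  have hw: "(\<lambda>w. f (z, w)) holomorphic_on ball 0 \<rho>" if "norm z < r" for z
    by (rule hol2_curve[OF f]) (use that \<rho> in \<open>auto intro!: holomorphic_intros\<close>)
  have tb: "norm (f (z, w) - (\<Sum>i<n. (deriv ^^ i) (\<lambda>z. f (z, w)) 0 / fact i * z ^ i)) \<le> 2 * B * (norm z / \<rho>) ^ n"
    if "norm w \<le> \<rho>" "norm z \<le> \<rho> / 2" for w z n
    by (rule holomorphic_taylor_bound[OF hz \<rho>]) (use that \<rho> B in auto)
  have t2: "norm (f (z, w) - (f (0, w) + f1 w * z)) \<le> 2 * B * (norm z / \<rho>) ^ 2"
    if "norm w \<le> \<rho>" "norm z \<le> \<rho> / 2" for w z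
    using tb[OF that, of 2] by (simp add: f1_def eval_nat_numeral)
  have t3: "norm (f (z, w) - (f (0, w) + f1 w * z + f2 w * z\<^sup>2)) \<le> 2 * B * (norm z / \<rho>) ^ 3"
    if "norm w \<le> \<rho>" "norm z \<le> \<rho> / 2" for w z
    using tb[OF that, of 3] by (simp add: f1_def f2_def eval_nat_numeral)
  have h1: "f1 holomorphic_on ball 0 \<rho>"
  proof (rule holomorphic_of_linear_rate[where d = "\<rho> / 2" and G = "\<lambda>h w. (f (h, w) - f (0, w)) / h" and C = "2 * B / \<rho> ^ 2"])
    fix h w :: complex assume h: "h \<noteq> 0" "norm h < \<rho> / 2" and w: "w \<in> ball 0 \<rho>"
    have "norm ((f (h, w) - f (0, w)) / h - f1 w) = norm (f (h, w) - (f (0, w) + f1 w * h)) / norm h"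
      using h by (simp add: field_simps flip: norm_divide)
    also have "\<dots> \<le> 2 * B * (norm h / \<rho>) ^ 2 / norm h"
      using t2[of w h] h w by (intro divide_right_mono) auto
    also have "\<dots> = 2 * B / \<rho> ^ 2 * norm h"
      using h by (simp add: field_simps power2_eq_square)
    finally show "norm ((f (h, w) - f (0, w)) / h - f1 w) \<le> 2 * B / \<rho> ^ 2 * norm h" .
  qed (use \<rho> in \<open>auto intro!: holomorphic_intros hw\<close>)
  have h2: "f2 holomorphic_on ball 0 \<rho>"
  proof (rule holomorphic_of_linear_rate[where d = "\<rho> / 2" and G = "\<lambda>h w. (f (h, w) - f (0, w) - f1 w * h) / h\<^sup>2" and C = "2 * B / \<rho> ^ 3"])
    fix h w :: complex assume h: "h \<noteq> 0" "norm h < \<rho> / 2" and w: "w \<in> ball 0 \<rho>"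
    have "norm ((f (h, w) - f (0, w) - f1 w * h) / h\<^sup>2 - f2 w) = norm (f (h, w) - (f (0, w) + f1 w * h + f2 w * h\<^sup>2)) / norm (h\<^sup>2)"
      using h by (simp add: field_simps flip: norm_divide)
    also have "\<dots> \<le> 2 * B * (norm h / \<rho>) ^ 3 / norm (h\<^sup>2)"
      using t3[of w h] h w by (intro divide_right_mono) auto
    also have "\<dots> = 2 * B / \<rho> ^ 3 * norm h"
      using h by (simp add: field_simps power2_eq_square power3_eq_cube norm_mult)
    finally show "norm ((f (h, w) - f (0, w) - f1 w * h) / h\<^sup>2 - f2 w) \<le> 2 * B / \<rho> ^ 3 * norm h" .
  qed (use \<rho> in \<open>auto intro!: holomorphic_intros hw h1\<close>)
  show ?thesis
  proof (rule that[of f1 f2 "2 * B / \<rho> ^ 3"])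
    show "norm (f (z, w) - (f (0, w) + f1 w * z + f2 w * z\<^sup>2)) \<le> 2 * B / \<rho> ^ 3 * norm z ^ 3"
      if "norm z \<le> r / 4" "norm w < r / 2" for z w
      using t3[of w z] that by (simp add: \<rho>_def power_divide)
  qed (use h1 h2 in \<open>auto simp: \<rho>_def f1_def\<close>)
qed

section \<open>Identity theorem and polarization\<close>

lemma holomorphic_zero_of_real:
  assumes f: "f holomorphic_on ball 0 r" and r: "r > 0"
    and 0: "\<And>x::real. \<bar>x\<bar> < r \<Longrightarrow> f (of_real x) = 0" and z: "norm z < r"
  shows "f z = 0"
proof (rule analytic_continuation[OF f, where U = "of_real ` {-r<..<r}" and \<xi> = 0])
  show "0 islimpt complex_of_real ` {- r<..<r}"
    unfolding islimpt_approachable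
  proof (intro allI impI)
    fix e :: real assume "e > 0"
    then show "\<exists>x'\<in>complex_of_real ` {- r<..<r}. x' \<noteq> 0 \<and> dist x' 0 < e"
      using r by (intro bexI[of _ "complex_of_real (min e r / 2)"] imageI) auto
  qed
qed (use 0 z r in auto)

text \<open>In the coordinates \<open>z = p + \<i> * q\<close>,
  \<open>\<zeta> = p - \<i> * q\<close> the antidiagonal \<open>\<zeta> = cnj z\<close> is the real
  plane. The identity theorem is applied first in \<open>q\<close> with \<open>p\<close> real, then
  in \<open>p\<close>. Holomorphy is required along curves only, which is what
  \<open>hol2_curve\<close> and \<open>dser_holomorphic\<close> provide.\<close>

lemma polarization_zero:
  assumes hol: "\<And>S p q. open S \<Longrightarrow> p holomorphic_on S \<Longrightarrow> q holomorphic_on S \<Longrightarrow>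
      (\<And>t. t \<in> S \<Longrightarrow> norm (p t) < \<delta>) \<Longrightarrow> (\<And>t. t \<in> S \<Longrightarrow> norm (q t) < \<delta>) \<Longrightarrow>
      (\<lambda>t. h (p t) (q t)) holomorphic_on S"
    and diag: "\<And>z. norm z < \<delta> \<Longrightarrow> h z (cnj z) = 0"
    and z: "norm z < \<delta> / 2" "norm \<zeta> < \<delta> / 2"
  shows "h z \<zeta> = (0::complex)"
proof -
  have \<delta>: "\<delta> > 0" using z norm_ge_zero[of z] by linarith
  have n: "norm (p + \<i> * q) < \<delta>" "norm (p - \<i> * q) < \<delta>" if "norm p < \<delta> / 2" "norm q < \<delta> / 2" for p q
    using that norm_triangle_ineq[of p "\<i> * q"] norm_triangle_ineq4[of p "\<i> * q"] by (auto simp: norm_mult)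
  have 1: "h (of_real p + \<i> * q) (of_real p - \<i> * q) = 0" if "\<bar>p\<bar> < \<delta> / 2" "norm q < \<delta> / 2" for p :: real and q
  proof (rule holomorphic_zero_of_real[OF _ _ _ that(2), of "\<lambda>q. h (of_real p + \<i> * q) (of_real p - \<i> * q)"])
    show "(\<lambda>q. h (of_real p + \<i> * q) (of_real p - \<i> * q)) holomorphic_on ball 0 (\<delta> / 2)"
      by (rule hol) (use that in \<open>auto intro!: holomorphic_intros n\<close>)
    fix x :: real assume "\<bar>x\<bar> < \<delta> / 2"
    then show "h (of_real p + \<i> * of_real x) (of_real p - \<i> * of_real x) = 0"
      using diag[of "of_real p + \<i> * of_real x"] n(1)[of "of_real p" "of_real x"] that by simp
  qed (use \<delta> in auto)
  have 2: "h (p + \<i> * q) (p - \<i> * q) = 0" if "norm p < \<delta> / 2" "norm q < \<delta> / 2" for p q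
  proof (rule holomorphic_zero_of_real[OF _ _ _ that(1), of "\<lambda>p. h (p + \<i> * q) (p - \<i> * q)"])
    show "(\<lambda>p. h (p + \<i> * q) (p - \<i> * q)) holomorphic_on ball 0 (\<delta> / 2)"
      by (rule hol) (use that in \<open>auto intro!: holomorphic_intros n\<close>)
  qed (use \<delta> 1 that in auto)
  have "norm ((z + \<zeta>) / 2) < \<delta> / 2" "norm ((z - \<zeta>) / (2 * \<i>)) < \<delta> / 2"
    using z norm_triangle_ineq[of z \<zeta>] norm_triangle_ineq4[of z \<zeta>] by (auto simp: norm_divide norm_mult)
  from 2[OF this] show ?thesis by (simp add: field_simps)
qed

section \<open>Double power series in \<open>z\<close> and \<open>\<zeta>\<close>\<close>

definition dser :: "(nat \<Rightarrow> nat \<Rightarrow> complex) \<Rightarrow> complex \<Rightarrow> complex \<Rightarrow> complex" where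
  "dser N z \<zeta> = (\<Sum>\<^sub>\<infinity>(k, l)\<in>UNIV. N k l * z ^ k * \<zeta> ^ l)"

text \<open>Absolute convergence at the corner \<open>(s, s)\<close>; its terms majorize the series
  on the whole closed bidisc of radius \<open>s\<close>.\<close>

definition dsummable :: "real \<Rightarrow> (nat \<Rightarrow> nat \<Rightarrow> complex) \<Rightarrow> bool" where
  "dsummable s N \<longleftrightarrow> (\<lambda>(k, l). norm (N k l) * s ^ k * s ^ l) summable_on UNIV"

lemma dser_term_le:
  fixes s :: real and a z \<zeta> :: complex
  assumes "norm z \<le> s" "norm \<zeta> \<le> s"
  shows "norm (a * z ^ k * \<zeta> ^ l) \<le> norm a * s ^ k * s ^ l"
proof -
  have "0 \<le> s" using assms norm_ge_zero order_trans by blast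
  then show ?thesis unfolding norm_mult norm_power using assms
    by (intro mult_mono power_mono mult_nonneg_nonneg) auto
qed

lemma dser_summable:
  assumes "dsummable s N" "norm z \<le> s" "norm \<zeta> \<le> s"
  shows "(\<lambda>(k, l). N k l * z ^ k * \<zeta> ^ l) summable_on UNIV"
  by (rule abs_summable_summable, rule summable_on_comparison_test[OF assms(1)[unfolded dsummable_def]])
     (use dser_term_le[OF assms(2,3)] in auto)

lemma dser_holomorphic:
  assumes N: "dsummable s N" and S: "open S" and p: "p holomorphic_on S" and q: "q holomorphic_on S"
    and le: "\<And>t. t \<in> S \<Longrightarrow> norm (p t) < s" "\<And>t. t \<in> S \<Longrightarrow> norm (q t) < s"
  shows "(\<lambda>t. dser N (p t) (q t)) holomorphic_on S"
  unfolding holomorphic_on_open[OF S]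
proof
  fix x assume "x \<in> S"
  then obtain e where e: "e > 0" "cball x e \<subseteq> S" using S open_contains_cball by blast
  let ?F = "\<lambda>X t. \<Sum>kl\<in>X. (\<lambda>(k, l). N k l * p t ^ k * q t ^ l) kl"
  have ul: "uniform_limit (cball x e) ?F (\<lambda>t. dser N (p t) (q t)) (finite_subsets_at_top UNIV)"
    unfolding dser_def
  proof (rule Weierstrass_m_test_general[OF _ N[unfolded dsummable_def]])
    fix kl :: "nat \<times> nat" and t assume "t \<in> cball x e"
    then have "norm (p t) \<le> s" "norm (q t) \<le> s" using le e by (meson less_imp_le subsetD)+
    from dser_term_le[OF this]
    show "norm (case kl of (k, l) \<Rightarrow> N k l * p t ^ k * q t ^ l) \<le> (case kl of (k, l) \<Rightarrow> norm (N k l) * s ^ k * s ^ l)"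
      by (auto split: prod.split)
  qed
  have hol: "?F X holomorphic_on cball x e" for X
    unfolding case_prod_unfold
    by (intro holomorphic_intros holomorphic_on_subset[OF p] holomorphic_on_subset[OF q] e)
  have "\<forall>\<^sub>F X in finite_subsets_at_top UNIV. continuous_on (cball x e) (?F X) \<and> ?F X holomorphic_on ball x e"
    using hol by (intro always_eventually allI)
      (meson ball_subset_cball holomorphic_on_imp_continuous_on holomorphic_on_subset)
  then have "(\<lambda>t. dser N (p t) (q t)) holomorphic_on ball x e"
    using holomorphic_uniform_limit[OF _ ul] by auto
  then show "\<exists>f'. ((\<lambda>t. dser N (p t) (q t)) has_field_derivative f') (at x)"
    using e holomorphic_derivI[of _ "ball x e" x] by auto
qed

text \<open>Relative to the majorant at \<open>(s, s)\<close>, each term with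
  \<open>k \<ge> m\<close> and \<open>l \<ge> m'\<close> carries the additional factor
  \<open>(norm z / s) ^ m * (norm \<zeta> / s) ^ m'\<close>.\<close>

lemma dser_bound:
  assumes N: "dsummable s N" and s: "s > 0" and 0: "\<And>k l. k < m \<or> l < m' \<Longrightarrow> N k l = 0"
  obtains C where "\<And>z \<zeta>. norm z \<le> s \<Longrightarrow> norm \<zeta> \<le> s \<Longrightarrow>
     norm (dser N z \<zeta>) \<le> C * norm z ^ m * norm \<zeta> ^ m'"
proof -
  define C where "C = (\<Sum>\<^sub>\<infinity>(k, l)\<in>UNIV. norm (N k l) * s ^ k * s ^ l)"
  have "norm (dser N z \<zeta>) \<le> C / (s ^ m * s ^ m') * norm z ^ m * norm \<zeta> ^ m'" if zs: "norm z \<le> s" "norm \<zeta> \<le> s" for z \<zeta>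
  proof -
    let ?c = "(norm z / s) ^ m * (norm \<zeta> / s) ^ m'"
    have pw: "x ^ k \<le> (x / s) ^ m * s ^ k" if "m \<le> k" "0 \<le> x" "x \<le> s" for k m and x :: real
    proof -
      have "x ^ k = (x / s) ^ k * s ^ k" using s by (simp add: power_divide)
      also have "\<dots> \<le> (x / s) ^ m * s ^ k"
        using that s by (intro mult_right_mono power_decreasing) auto
      finally show ?thesis .
    qed
    have t: "norm (N k l * z ^ k * \<zeta> ^ l) \<le> ?c * (norm (N k l) * s ^ k * s ^ l)" for k l
    proof (cases "k < m \<or> l < m'")
      case False
      have "norm (N k l) * (norm z ^ k * norm \<zeta> ^ l) \<le> norm (N k l) * (((norm z / s) ^ m * s ^ k) * ((norm \<zeta> / s) ^ m' * s ^ l))"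
        using False zs s by (intro mult_left_mono mult_mono pw) auto
      then show ?thesis by (simp add: norm_mult norm_power mult_ac)
    qed (use 0 in auto)
    have "norm (dser N z \<zeta>) \<le> (\<Sum>\<^sub>\<infinity>(k, l)\<in>UNIV. ?c * (norm (N k l) * s ^ k * s ^ l))"
      unfolding dser_def
    proof (rule norm_infsum_le)
      show "((\<lambda>(k, l). N k l * z ^ k * \<zeta> ^ l) has_sum (\<Sum>\<^sub>\<infinity>(k, l)\<in>UNIV. N k l * z ^ k * \<zeta> ^ l)) UNIV"
        by (rule has_sum_infsum[OF dser_summable[OF N zs]])
      have "(\<lambda>kl. ?c * (case kl of (k, l) \<Rightarrow> norm (N k l) * s ^ k * s ^ l)) summable_on UNIV"
        by (rule summable_on_cmult_right[OF N[unfolded dsummable_def]])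
      then show "((\<lambda>(k, l). ?c * (norm (N k l) * s ^ k * s ^ l)) has_sum (\<Sum>\<^sub>\<infinity>(k, l)\<in>UNIV. ?c * (norm (N k l) * s ^ k * s ^ l))) UNIV"
        by (intro has_sum_infsum) (simp add: case_prod_unfold)
    qed (use t in auto)
    also have "\<dots> = ?c * C"
      unfolding C_def by (simp add: case_prod_unfold infsum_cmult_right')
    finally show ?thesis by (simp add: power_divide mult_ac)
  qed
  then show ?thesis by (rule that)
qed

text \<open>The series splits into the row \<open>k = 2\<close> and the rows
  \<open>k \<ge> 3\<close>. The function \<open>n\<close> is the series of the second row; its order
  of vanishing at 0 is how umbilicity enters the argument.\<close>

lemma dser_row2:
  assumes N: "dsummable s N" and s: "s > 0" and 0: "\<And>k l. k < 2 \<Longrightarrow> N k l = 0"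
  obtains n C where
    "\<And>z \<zeta>. norm z \<le> s \<Longrightarrow> norm \<zeta> \<le> s \<Longrightarrow> norm (dser N z \<zeta> - n \<zeta> * z\<^sup>2) \<le> C * norm z ^ 3"
    "\<And>m. (\<And>l. l < m \<Longrightarrow> N 2 l = 0) \<Longrightarrow> \<exists>D. \<forall>\<zeta>. norm \<zeta> \<le> s \<longrightarrow> norm (n \<zeta>) \<le> D * norm \<zeta> ^ m"
proof -
  define P where "P = (\<lambda>k l. if k = 2 then N k l else 0)"
  define Q where "Q = (\<lambda>k l. if k = 2 then 0 else N k l)"
  have PQ: "dsummable s P" "dsummable s Q" unfolding dsummable_def
    by (rule summable_on_comparison_test[OF N[unfolded dsummable_def]], use s in \<open>auto simp: P_def Q_def\<close>)+
  \<comment> \<open>The row is homogeneous of degree 2 in \<open>z\<close>, so its coefficient can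
    be read off at the point \<open>z = s\<close>.\<close>
  define n where "n = (\<lambda>\<zeta>. dser P (of_real s) \<zeta> / of_real s ^ 2)"
  have split: "dser N z \<zeta> = dser P z \<zeta> + dser Q z \<zeta>" if "norm z \<le> s" "norm \<zeta> \<le> s" for z \<zeta>
  proof -
    have "dser P z \<zeta> + dser Q z \<zeta> = (\<Sum>\<^sub>\<infinity>kl\<in>UNIV. (case kl of (k, l) \<Rightarrow> P k l * z ^ k * \<zeta> ^ l) + (case kl of (k, l) \<Rightarrow> Q k l * z ^ k * \<zeta> ^ l))"
      unfolding dser_def using PQ[THEN dser_summable, OF that] by (intro infsum_add[symmetric])
    also have "\<dots> = dser N z \<zeta>" unfolding dser_def
      by (rule infsum_cong) (auto simp: P_def Q_def)
    finally show ?thesis by simp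
  qed
  have row: "dser P z \<zeta> = n \<zeta> * z\<^sup>2" for z \<zeta>
  proof -
    have "dser P z \<zeta> = (\<Sum>\<^sub>\<infinity>kl\<in>UNIV. (z\<^sup>2 / of_real s ^ 2) * (case kl of (k, l) \<Rightarrow> P k l * of_real s ^ k * \<zeta> ^ l))"
      unfolding dser_def by (rule infsum_cong) (use s in \<open>auto simp: P_def\<close>)
    also have "\<dots> = (z\<^sup>2 / of_real s ^ 2) * dser P (of_real s) \<zeta>"
      unfolding dser_def by (rule infsum_cmult_right')
    finally show ?thesis by (simp add: n_def)
  qed
  have Q0: "Q k l = 0" if "k < 3 \<or> l < 0" for k l
  proof -
    have "k < 2 \<or> k = 2" using that by auto
    then show ?thesis using 0 by (auto simp: Q_def)
  qed
  obtain C where C: "\<And>z \<zeta>. norm z \<le> s \<Longrightarrow> norm \<zeta> \<le> s \<Longrightarrow> norm (dser Q z \<zeta>) \<le> C * norm z ^ 3 * norm \<zeta> ^ 0"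
    using dser_bound[OF PQ(2) s Q0, where m' = 0] by blast
  show ?thesis
  proof (rule that[of n C])
    show "norm (dser N z \<zeta> - n \<zeta> * z\<^sup>2) \<le> C * norm z ^ 3" if "norm z \<le> s" "norm \<zeta> \<le> s" for z \<zeta>
      using C[OF that] by (simp add: split[OF that] row)
    show "\<exists>D. \<forall>\<zeta>. norm \<zeta> \<le> s \<longrightarrow> norm (n \<zeta>) \<le> D * norm \<zeta> ^ m" if m: "\<And>l. l < m \<Longrightarrow> N 2 l = 0" for m
    proof -
      obtain D where D: "\<And>z \<zeta>. norm z \<le> s \<Longrightarrow> norm \<zeta> \<le> s \<Longrightarrow> norm (dser P z \<zeta>) \<le> D * norm z ^ 0 * norm \<zeta> ^ m"
        by (rule dser_bound[OF PQ(1) s, of 0 m]) (use m in \<open>auto simp: P_def\<close>)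
      have "norm (n \<zeta>) \<le> (D / s\<^sup>2) * norm \<zeta> ^ m" if "norm \<zeta> \<le> s" for \<zeta>
        using D[of "of_real s" \<zeta>] that s by (simp add: n_def norm_divide norm_power divide_right_mono)
      then show ?thesis by blast
    qed
  qed
qed

section \<open>Comparison of polynomial coefficients\<close>

lemma poly_coeff_zero_of_bound:
  fixes p :: "complex poly"
  assumes "eventually (\<lambda>x. norm (poly p x) \<le> C * norm x ^ n) (at 0)" "i < n"
  shows "coeff p i = 0"
  using assms
proof (induction n arbitrary: p i)
  case (Suc n)
  obtain a p' where p: "p = pCons a p'" by (cases p)
  have a: "a = 0"
  proof -
    have "(poly p \<longlongrightarrow> 0) (at 0)"
      by (rule Lim_null_comparison[OF Suc.prems(1)]) (auto intro!: tendsto_eq_intros)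
    moreover have "(poly p \<longlongrightarrow> poly p 0) (at 0)" by (intro tendsto_intros)
    ultimately show ?thesis using LIM_unique p by fastforce
  qed
  have "eventually (\<lambda>x. norm (poly p' x) \<le> C * norm x ^ n) (at 0)"
    using Suc.prems(1) eventually_neq_at_within[of 0 0]
  proof eventually_elim
    case (elim x)
    then have "norm x * norm (poly p' x) \<le> norm x * (C * norm x ^ n)"
      by (simp add: p a norm_mult mult_ac)
    then show ?case using elim by simp
  qed
  from Suc.IH[OF this] Suc.prems(2) show ?case by (cases i) (auto simp: p a)
qed simp

text \<open>Up to a constant the cubic agrees through degree 4 with the power 3/2 of the quadratic,
  so the degree 4 coefficient of that power must vanish. For
  \<open>1 + s1 * x + s2 * x\<^sup>2\<close> this coefficient is 3/128 times
  \<open>(4 * s2 - s1\<^sup>2)\<^sup>2\<close>.\<close>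

lemma cube_of_quadratic_square_mod5:
  fixes \<kappa> q0 q1 q2 q3 Q0 Q1 Q2 :: complex
  assumes ev: "eventually (\<lambda>x. norm (\<kappa> * (q0 + q1 * x + q2 * x\<^sup>2 + q3 * x ^ 3)\<^sup>2 - (Q0 + Q1 * x + Q2 * x\<^sup>2) ^ 3)
      \<le> C * norm x ^ 5) (at 0)"
    and Q0: "Q0 \<noteq> 0"
  shows "4 * Q0 * Q2 = Q1\<^sup>2"
proof -
  define p where "p = smult \<kappa> ([:q0, q1, q2, q3:] ^ 2) - [:Q0, Q1, Q2:] ^ 3"
  have "eventually (\<lambda>x. norm (poly p x) \<le> C * norm x ^ 5) (at 0)"
    using ev by eventually_elim (simp add: p_def poly_power algebra_simps power2_eq_square power3_eq_cube)
  then have co: "coeff p i = 0" if "i < 5" for i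
    using poly_coeff_zero_of_bound that by blast
  have e0: "\<kappa> * q0\<^sup>2 = Q0 ^ 3"
    using co[of 0] by (simp add: p_def power2_eq_square power3_eq_cube)
  have e1: "\<kappa> * (2 * q0 * q1) = 3 * Q0\<^sup>2 * Q1"
    using co[of 1] by (simp add: p_def power2_eq_square power3_eq_cube algebra_simps)
  have e2: "\<kappa> * (2 * q0 * q2 + q1\<^sup>2) = 3 * Q0\<^sup>2 * Q2 + 3 * Q0 * Q1\<^sup>2"
    using co[of 2] by (simp add: p_def power2_eq_square power3_eq_cube algebra_simps eval_nat_numeral)
  have e3: "\<kappa> * (2 * q0 * q3 + 2 * q1 * q2) = 6 * Q0 * Q1 * Q2 + Q1 ^ 3"
    using co[of 3] by (simp add: p_def power2_eq_square power3_eq_cube algebra_simps eval_nat_numeral)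
  have e4: "\<kappa> * (2 * q1 * q3 + q2\<^sup>2) = 3 * Q0 * Q2\<^sup>2 + 3 * Q1\<^sup>2 * Q2"
    using co[of 4] by (simp add: p_def power2_eq_square power3_eq_cube algebra_simps eval_nat_numeral)
  have nz: "q0 \<noteq> 0" "\<kappa> \<noteq> 0" using e0 Q0 by auto
  define t1 t2 t3 s1 s2 where "t1 = q1 / q0" "t2 = q2 / q0" "t3 = q3 / q0" "s1 = Q1 / Q0" "s2 = Q2 / Q0"
  have q: "q1 = q0 * t1" "q2 = q0 * t2" "q3 = q0 * t3" "Q1 = Q0 * s1" "Q2 = Q0 * s2"
    using nz Q0 by (auto simp: t1_t2_t3_s1_s2_def)
  have cancel: "l = r" if "\<kappa> * (q0\<^sup>2 * l) = Q0 ^ 3 * r" for l r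
  proof -
    have "Q0 ^ 3 * l = Q0 ^ 3 * r" using that e0 by (metis mult.assoc)
    then show ?thesis using Q0 by simp
  qed
  have f1: "2 * t1 = 3 * s1"
    by (rule cancel) (use e1 in \<open>simp add: q power2_eq_square power3_eq_cube algebra_simps\<close>)
  have f2: "2 * t2 + t1\<^sup>2 = 3 * s2 + 3 * s1\<^sup>2"
    by (rule cancel) (use e2 in \<open>simp add: q power2_eq_square power3_eq_cube algebra_simps\<close>)
  have f3: "2 * t3 + 2 * t1 * t2 = 6 * s1 * s2 + s1 ^ 3"
    by (rule cancel) (use e3 in \<open>simp add: q power2_eq_square power3_eq_cube algebra_simps\<close>)
  have f4: "2 * t1 * t3 + t2\<^sup>2 = 3 * s2\<^sup>2 + 3 * s1\<^sup>2 * s2"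
    by (rule cancel) (use e4 in \<open>simp add: q power2_eq_square power3_eq_cube algebra_simps\<close>)
  \<comment> \<open>The equations \<open>f1\<close>, \<open>f2\<close>, \<open>f3\<close> determine
    \<open>t1\<close>, \<open>t2\<close>, \<open>t3\<close> from \<open>s1\<close>,
    \<open>s2\<close>; substitution into \<open>f4\<close> leaves a multiple of this square.\<close>
  have "(4 * s2 - s1\<^sup>2)\<^sup>2 = 0"
    using f1 f2 f3 f4 by algebra
  then have "4 * s2 = s1\<^sup>2" by simp
  then show ?thesis by (simp add: q power2_eq_square mult_ac)
qed

text \<open>First \<open>f\<close> is expanded in \<open>z\<close> with coefficients holomorphic in
  \<open>w\<close>, then each coefficient is composed with the curve \<open>w\<close>. The error
  bound has to be uniform in the second argument because \<open>w z\<close> moves with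
  \<open>z\<close>.\<close>

lemma taylor2_hol2:
  assumes f: "hol2 r f" and r: "0 < r"
    and f1: "f1 holomorphic_on ball 0 (r / 2)" and f2: "f2 holomorphic_on ball 0 (r / 2)"
    and bd: "\<And>z w. norm z \<le> r / 4 \<Longrightarrow> norm w < r / 2 \<Longrightarrow>
       norm (f (z, w) - (f (0, w) + f1 w * z + f2 w * z\<^sup>2)) \<le> C * norm z ^ 3"
    and w: "taylor2 w u w1 w2" and u: "norm u < r / 2"
  shows "taylor2 (\<lambda>z. f (z, w z)) (f (0, u)) (deriv (\<lambda>w. f (0, w)) u * w1 + f1 u)
     (deriv (\<lambda>w. f (0, w)) u * w2 + deriv (deriv (\<lambda>w. f (0, w))) u / 2 * w1\<^sup>2 + deriv f1 u * w1 + f2 u)"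
proof -
  define R where "R = r / 2 - norm u"
  have R: "R > 0" using u by (simp add: R_def)
  have sub: "ball u R \<subseteq> ball 0 (r / 2)"
  proof
    fix x assume "x \<in> ball u R"
    then show "x \<in> ball 0 (r / 2)"
      using norm_triangle_sub[of x u] by (simp add: R_def dist_norm norm_minus_commute)
  qed
  have f0: "(\<lambda>w. f (0, w)) holomorphic_on ball u R"
    by (rule hol2_curve[OF f]) (use r sub in \<open>auto intro!: holomorphic_intros\<close>)
  have c0: "taylor2 (\<lambda>z. f (0, w z)) (f (0, u)) (deriv (\<lambda>w. f (0, w)) u * w1)
      (deriv (\<lambda>w. f (0, w)) u * w2 + deriv (deriv (\<lambda>w. f (0, w))) u / 2 * w1\<^sup>2)"
    by (rule taylor2_compose[OF w f0 R])
  have c1: "taylor2 (\<lambda>z. f1 (w z)) (f1 u) (deriv f1 u * w1) (deriv f1 u * w2 + deriv (deriv f1) u / 2 * w1\<^sup>2)"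
    by (rule taylor2_compose[OF w holomorphic_on_subset[OF f1 sub] R])
  have c2: "taylor2 (\<lambda>z. f2 (w z)) (f2 u) (deriv f2 u * w1) (deriv f2 u * w2 + deriv (deriv f2) u / 2 * w1\<^sup>2)"
    by (rule taylor2_compose[OF w holomorphic_on_subset[OF f2 sub] R])
  have main: "taylor2 (\<lambda>z. f (0, w z) + f1 (w z) * z + f2 (w z) * z\<^sup>2) (f (0, u)) (deriv (\<lambda>w. f (0, w)) u * w1 + f1 u)
     (deriv (\<lambda>w. f (0, w)) u * w2 + deriv (deriv (\<lambda>w. f (0, w))) u / 2 * w1\<^sup>2 + deriv f1 u * w1 + f2 u)"
    using taylor2_add[OF taylor2_add[OF c0 taylor2_mult[OF c1 taylor2_id]]
        taylor2_mult[OF c2 taylor2_mult[OF taylor2_id taylor2_id]]]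
    by (simp add: power2_eq_square)
  show ?thesis
  proof (rule taylor2_cong_bigo[OF main])
    have "eventually (\<lambda>z. w z \<in> ball 0 (r / 2)) (nhds 0)"
      using topological_tendstoD[OF taylor2_tendsto[OF w], of "ball 0 (r / 2)"] u by auto
    moreover have "eventually (\<lambda>z. z \<in> ball 0 (r / 4)) (nhds (0::complex))"
      using r by (intro eventually_nhds_in_open) auto
    ultimately have "eventually (\<lambda>z. norm (f (z, w z) - (f (0, w z) + f1 (w z) * z + f2 (w z) * z\<^sup>2)) \<le> C * norm (z ^ 3)) (nhds 0)"
    proof eventually_elim
      case (elim z)
      then show ?case using bd[of z "w z"] by (simp add: norm_power)
    qed
    then show "(\<lambda>z. f (z, w z) - (f (0, w z) + f1 (w z) * z + f2 (w z) * z\<^sup>2)) \<in> O[nhds 0](\<lambda>z. z ^ 3)"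
      by (rule bigoI)
  qed
qed

section \<open>Segre varieties in normalized coordinates\<close>

text \<open>\<open>X\<close> and \<open>Y\<close> stand for the logarithms of the components of the
  inverse normalizing map, shifted to vanish at the origin; \<open>c\<close> and \<open>d\<close>
  are the logarithms of the moduli at the base point. The outcome in this setting is that the
  Jacobian determinant of \<open>(X, Y)\<close> at the origin is zero, which is absurd for a
  biholomorphism.\<close>

locale normalized_tube =
  fixes r s c d \<epsilon> :: real and X Y :: "complex \<times> complex \<Rightarrow> complex"
    and N :: "nat \<Rightarrow> nat \<Rightarrow> real \<Rightarrow> complex"
  assumes s: "0 < s" "s \<le> r" and \<epsilon>: "\<epsilon> > 0" and cd: "c\<^sup>2 + d\<^sup>2 = \<epsilon>\<^sup>2"
    and X: "hol2 r X" and Y: "hol2 r Y" and X0: "X (0, 0) = 0" and Y0: "Y (0, 0) = 0"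
    and N0: "\<And>k l u. k < 2 \<or> l < 2 \<Longrightarrow> N k l u = 0"
    and Nherm: "\<And>k l u. N l k u = cnj (N k l u)"
    and N2: "N 2 2 0 = 0" "N 2 3 0 = 0" "N 2 4 0 = 0"
    and Nsum: "\<And>u. \<bar>u\<bar> < r \<Longrightarrow> dsummable s (\<lambda>k l. N k l u)"
    and tube: "\<And>z w. norm z < s \<Longrightarrow> norm w < r \<Longrightarrow>
       Im w = (norm z)\<^sup>2 + Re (dser (\<lambda>k l. N k l (Re w)) z (cnj z)) \<Longrightarrow>
       (Re (X (z, w)) + c)\<^sup>2 + (Re (Y (z, w)) + d)\<^sup>2 = \<epsilon>\<^sup>2"
begin

text \<open>The antiholomorphic arguments \<open>cnj z\<close>, \<open>cnj w\<close> are replaced by independent variables \<open>\<zeta>\<close>, \<open>\<omega>\<close>: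
  on the complexified hypersurface \<open>X (z, w) + A (\<zeta>, \<omega>)\<close> plays the role of \<open>2 (Re X + c)\<close>.\<close>

definition A :: "complex \<times> complex \<Rightarrow> complex" where
  "A x = cnj (X (cnj (fst x), cnj (snd x))) + 2 * of_real c"
definition B :: "complex \<times> complex \<Rightarrow> complex" where
  "B x = cnj (Y (cnj (fst x), cnj (snd x))) + 2 * of_real d"
text \<open>For \<open>\<zeta> = cnj z\<close> this is the height \<open>Im w\<close> of the
  hypersurface over \<open>z\<close> with \<open>Re w = u\<close>. In the complexification it gives
  \<open>w = u + \<i> * G\<close> and \<open>\<omega> = u - \<i> * G\<close>.\<close>

definition G :: "real \<Rightarrow> complex \<Rightarrow> complex \<Rightarrow> complex" where
  "G u z \<zeta> = z * \<zeta> + dser (\<lambda>k l. N k l u) z \<zeta>"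

lemma r: "r > 0" using s by simp

lemma hol2_A: "hol2 r A" and hol2_B: "hol2 r B"
  unfolding A_def[abs_def] B_def[abs_def] by (intro hol2_cnj X Y)+

text \<open>Conjugation exchanges the roles of \<open>k\<close> and \<open>l\<close>, and the
  Hermitian symmetry of \<open>N\<close> undoes the exchange; hence the sum is real.\<close>

lemma dser_diag:
  "dser (\<lambda>k l. N k l u) z (cnj z) = of_real (Re (dser (\<lambda>k l. N k l u) z (cnj z)))"
proof -
  let ?f = "\<lambda>(k, l). N k l u * z ^ k * cnj z ^ l"
  have "cnj (dser (\<lambda>k l. N k l u) z (cnj z)) = (\<Sum>\<^sub>\<infinity>kl\<in>UNIV. cnj (?f kl))"
    unfolding dser_def by (rule infsum_cnj[symmetric])
  also have "\<dots> = (\<Sum>\<^sub>\<infinity>kl\<in>UNIV. ?f (prod.swap kl))"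
    by (rule infsum_cong) (auto simp: Nherm[of _ _ u, symmetric] mult_ac)
  also have "\<dots> = (\<Sum>\<^sub>\<infinity>kl\<in>UNIV. ?f kl)"
    by (rule infsum_reindex_bij_betw) (rule bij_swap)
  finally have "cnj (dser (\<lambda>k l. N k l u) z (cnj z)) = dser (\<lambda>k l. N k l u) z (cnj z)"
    by (simp add: dser_def)
  then show ?thesis
    by (metis Reals_cnj_iff of_real_Re)
qed

text \<open>For fixed real \<open>u\<close> the doubled equation of the tube holds on
  \<open>\<zeta> = cnj z\<close>, and both sides are holomorphic in \<open>(z, \<zeta>)\<close>. The
  radius \<open>\<delta>\<close> may depend on \<open>u\<close>, since nothing relates
  \<open>N\<close> at different values of \<open>u\<close>.\<close>

lemma polarized:
  assumes u: "\<bar>u\<bar> < r"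
  obtains \<delta> where "\<delta> > 0" "\<delta> \<le> s"
    "\<And>z \<zeta>. norm z < \<delta> \<Longrightarrow> norm \<zeta> < \<delta> \<Longrightarrow>
      (X (z, of_real u + \<i> * G u z \<zeta>) + A (\<zeta>, of_real u - \<i> * G u z \<zeta>))\<^sup>2
      + (Y (z, of_real u + \<i> * G u z \<zeta>) + B (\<zeta>, of_real u - \<i> * G u z \<zeta>))\<^sup>2 = 4 * of_real \<epsilon> ^ 2"
proof -
  obtain C where C: "\<And>z \<zeta>. norm z \<le> s \<Longrightarrow> norm \<zeta> \<le> s \<Longrightarrow>
     norm (dser (\<lambda>k l. N k l u) z \<zeta>) \<le> C * norm z ^ 2 * norm \<zeta> ^ 0"
    by (rule dser_bound[OF Nsum[OF u] s(1), of 2 0]) (use N0 in auto)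
  \<comment> \<open>Chosen so that \<open>norm (G u z \<zeta>)\<close> is at most \<open>\<delta> *
    (\<delta> * (1 + \<bar>C\<bar>)) \<le> (r - \<bar>u\<bar>) / 2\<close>, which keeps
    \<open>u + \<i> * G\<close> and \<open>u - \<i> * G\<close> in the disc of radius
    \<open>r\<close>; the bound by 1 absorbs one factor \<open>\<delta>\<close>.\<close>
  define \<delta> where "\<delta> = min s (min 1 ((r - \<bar>u\<bar>) / (2 * (1 + \<bar>C\<bar>))))"
  have \<delta>: "\<delta> > 0" "\<delta> \<le> s" "\<delta> \<le> 1" using s u by (auto simp: \<delta>_def)
  have "\<delta> \<le> (r - \<bar>u\<bar>) / (2 * (1 + \<bar>C\<bar>))" by (simp add: \<delta>_def)
  then have \<delta>C: "\<delta> * (1 + \<bar>C\<bar>) \<le> (r - \<bar>u\<bar>) / 2" by (simp add: field_simps)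
  have Gb: "norm (G u z \<zeta>) < r - \<bar>u\<bar>" if "norm z < \<delta>" "norm \<zeta> < \<delta>" for z \<zeta>
  proof -
    have "norm (G u z \<zeta>) \<le> norm z * norm \<zeta> + norm (dser (\<lambda>k l. N k l u) z \<zeta>)"
      unfolding G_def by (metis norm_mult norm_triangle_ineq)
    also have "norm (dser (\<lambda>k l. N k l u) z \<zeta>) \<le> C * norm z ^ 2"
      using C[of z \<zeta>] that \<delta> by simp
    also have "C * norm z ^ 2 \<le> \<bar>C\<bar> * norm z ^ 2" by (intro mult_right_mono) auto
    also have "\<dots> \<le> \<bar>C\<bar> * \<delta> ^ 2" using that by (intro mult_left_mono power_mono) auto
    also have "norm z * norm \<zeta> \<le> \<delta> * \<delta>" using that \<delta> by (intro mult_mono) auto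
    finally have "norm (G u z \<zeta>) \<le> \<delta> * (\<delta> * (1 + \<bar>C\<bar>))"
      by (simp add: power2_eq_square algebra_simps)
    also have "\<dots> \<le> 1 * (\<delta> * (1 + \<bar>C\<bar>))" using \<delta> by (intro mult_right_mono) auto
    also have "\<dots> \<le> (r - \<bar>u\<bar>) / 2" using \<delta>C by simp
    also have "\<dots> < r - \<bar>u\<bar>" using u by simp
    finally show ?thesis .
  qed
  have wb: "norm (of_real u + \<i> * G u z \<zeta>) < r" "norm (of_real u - \<i> * G u z \<zeta>) < r"
    if "norm z < \<delta>" "norm \<zeta> < \<delta>" for z \<zeta>
    using Gb[OF that] norm_triangle_ineq[of "of_real u" "\<i> * G u z \<zeta>"]
      norm_triangle_ineq4[of "of_real u" "\<i> * G u z \<zeta>"] by (auto simp: norm_mult)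
  define h where "h = (\<lambda>z \<zeta>. (X (z, of_real u + \<i> * G u z \<zeta>) + A (\<zeta>, of_real u - \<i> * G u z \<zeta>))\<^sup>2
      + (Y (z, of_real u + \<i> * G u z \<zeta>) + B (\<zeta>, of_real u - \<i> * G u z \<zeta>))\<^sup>2 - 4 * of_real \<epsilon> ^ 2)"
  have "h z \<zeta> = 0" if "norm z < \<delta> / 2" "norm \<zeta> < \<delta> / 2" for z \<zeta>
  proof (rule polarization_zero[OF _ _ that])
    fix S p q assume S: "open S" and pq: "p holomorphic_on S" "q holomorphic_on S"
      and le: "\<And>t. t \<in> S \<Longrightarrow> norm (p t) < \<delta>" "\<And>t. t \<in> S \<Longrightarrow> norm (q t) < \<delta>"
    have les: "norm (p t) < s" "norm (q t) < s" "norm (p t) < r" "norm (q t) < r" if "t \<in> S" for t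
      using le[OF that] \<delta> s by auto
    have Gh: "(\<lambda>t. G u (p t) (q t)) holomorphic_on S"
      unfolding G_def by (intro holomorphic_intros pq dser_holomorphic[OF Nsum[OF u] S] les)
    show "(\<lambda>t. h (p t) (q t)) holomorphic_on S"
      unfolding h_def
      by (intro holomorphic_intros hol2_curve[OF X S] hol2_curve[OF Y S] hol2_curve[OF hol2_A S]
          hol2_curve[OF hol2_B S] pq Gh les wb le)
  next
    fix z :: complex assume z: "norm z < \<delta>"
    define g where "g = (norm z)\<^sup>2 + Re (dser (\<lambda>k l. N k l u) z (cnj z))"
    have g: "G u z (cnj z) = of_real g"
      unfolding G_def g_def of_real_add dser_diag[of u z, symmetric] by (simp only: complex_norm_square)
    define w where "w = of_real u + \<i> * of_real g"
    have w: "norm w < r" "Re w = u" "Im w = g"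
      using wb(1)[of z "cnj z"] z g by (auto simp: w_def)
    have e: "(Re (X (z, w)) + c)\<^sup>2 + (Re (Y (z, w)) + d)\<^sup>2 = \<epsilon>\<^sup>2"
      by (rule tube) (use w z \<delta> in \<open>auto simp: g_def\<close>)
    have "of_real u - \<i> * of_real g = cnj w" by (simp add: w_def)
    then have "h z (cnj z) = (X (z, w) + (cnj (X (z, w)) + 2 * of_real c))\<^sup>2
        + (Y (z, w) + (cnj (Y (z, w)) + 2 * of_real d))\<^sup>2 - 4 * of_real \<epsilon> ^ 2"
      by (simp add: h_def g A_def B_def w_def)
    also have "\<dots> = (2 * of_real (Re (X (z, w)) + c))\<^sup>2 + (2 * of_real (Re (Y (z, w)) + d))\<^sup>2 - 4 * of_real \<epsilon> ^ 2"
      using complex_add_cnj[of "X (z, w)"] complex_add_cnj[of "Y (z, w)"]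
      by (simp add: add.assoc[symmetric] distrib_left)
    also have "\<dots> = 4 * (of_real ((Re (X (z, w)) + c)\<^sup>2 + (Re (Y (z, w)) + d)\<^sup>2) - of_real (\<epsilon>\<^sup>2))"
      by (simp add: power2_eq_square algebra_simps)
    also have "\<dots> = 0" unfolding e by simp
    finally show "h z (cnj z) = 0" .
  qed
  then show ?thesis using \<delta> by (intro that[of "\<delta> / 2"]) (auto simp: h_def)
qed

section \<open>Continuation in \<open>u\<close> and the jets at \<open>z = 0\<close>\<close>

lemma G_zero: assumes "\<bar>u\<bar> < r" "norm \<zeta> \<le> s" shows "G u 0 \<zeta> = 0"
proof -
  obtain C where C: "\<And>z \<zeta>. norm z \<le> s \<Longrightarrow> norm \<zeta> \<le> s \<Longrightarrow>
     norm (dser (\<lambda>k l. N k l u) z \<zeta>) \<le> C * norm z ^ 2 * norm \<zeta> ^ 0"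
    by (rule dser_bound[OF Nsum[OF assms(1)] s(1), of 2 0]) (use N0 in auto)
  from C[of 0 \<zeta>] show ?thesis using assms s by (simp add: G_def)
qed

text \<open>The order matters: for each real \<open>u\<close> the identity is first extended from
  its own small disc, of radius depending on \<open>u\<close>, to all
  \<open>norm \<zeta> < r\<close>. Only then, with \<open>\<zeta>\<close> fixed, is it continued
  from real to complex \<open>u\<close>.\<close>

lemma continuation:
  assumes f: "\<And>u. norm u < \<rho> \<Longrightarrow> (\<lambda>\<zeta>. f \<zeta> u) holomorphic_on ball 0 r"
      "\<And>\<zeta>. norm \<zeta> < r \<Longrightarrow> f \<zeta> holomorphic_on ball 0 \<rho>"
    and \<rho>: "\<rho> > 0"
    and 0: "\<And>u::real. \<bar>u\<bar> < \<rho> \<Longrightarrow> \<exists>\<delta>>0. \<forall>\<zeta>. norm \<zeta> < \<delta> \<longrightarrow> f \<zeta> (of_real u) = (0::complex)"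
    and \<zeta>u: "norm \<zeta> < r" "norm u < \<rho>"
  shows "f \<zeta> u = 0"
proof (rule holomorphic_zero_of_real[OF f(2)[OF \<zeta>u(1)] \<rho> _ \<zeta>u(2)])
  fix x :: real assume x: "\<bar>x\<bar> < \<rho>"
  obtain \<delta> where \<delta>: "\<delta> > 0" "\<And>\<zeta>. norm \<zeta> < \<delta> \<Longrightarrow> f \<zeta> (of_real x) = 0" using 0[OF x] by blast
  show "f \<zeta> (of_real x) = 0"
  proof (rule analytic_continuation_open[where s = "ball 0 (min \<delta> r)" and s' = "ball 0 r" and g = "\<lambda>_. 0"
        and f = "\<lambda>\<zeta>. f \<zeta> (of_real x)"])
    show "(\<lambda>\<zeta>. f \<zeta> (of_real x)) holomorphic_on ball 0 r" using x by (intro f) auto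
  qed (use \<delta> r \<zeta>u in auto)
qed

lemma hol_slices:
  "norm \<zeta> < r \<Longrightarrow> (\<lambda>u. X (\<zeta>, u)) holomorphic_on ball 0 r"
  "norm \<zeta> < r \<Longrightarrow> (\<lambda>u. Y (\<zeta>, u)) holomorphic_on ball 0 r"
  "norm \<zeta> < r \<Longrightarrow> (\<lambda>u. A (\<zeta>, u)) holomorphic_on ball 0 r"
  "norm \<zeta> < r \<Longrightarrow> (\<lambda>u. B (\<zeta>, u)) holomorphic_on ball 0 r"
  "norm u < r \<Longrightarrow> (\<lambda>\<zeta>. A (\<zeta>, u)) holomorphic_on ball 0 r"
  "norm u < r \<Longrightarrow> (\<lambda>\<zeta>. B (\<zeta>, u)) holomorphic_on ball 0 r"
  by (rule hol2_curve[OF X] hol2_curve[OF Y] hol2_curve[OF hol2_A] hol2_curve[OF hol2_B];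
      auto intro!: holomorphic_intros)+

text \<open>At \<open>z = 0\<close> the function \<open>G\<close> vanishes, so \<open>N\<close>
  disappears from the polarized equation and what remains is holomorphic in both
  \<open>\<zeta>\<close> and \<open>u\<close>.\<close>

lemma leaf_at_zero:
  assumes "norm \<zeta> < r" "norm u < r"
  shows "(X (0, u) + A (\<zeta>, u))\<^sup>2 + (Y (0, u) + B (\<zeta>, u))\<^sup>2 = 4 * of_real \<epsilon> ^ 2"
proof -
  let ?f = "\<lambda>\<zeta> u. (X (0, u) + A (\<zeta>, u))\<^sup>2 + (Y (0, u) + B (\<zeta>, u))\<^sup>2 - 4 * of_real \<epsilon> ^ 2"
  have "?f \<zeta> u = 0"
  proof (rule continuation[where f = ?f, OF _ _ r _ assms])
    fix x :: real assume x: "\<bar>x\<bar> < r"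
    obtain \<delta> where \<delta>: "\<delta> > 0" "\<delta> \<le> s" "\<And>z \<zeta>. norm z < \<delta> \<Longrightarrow> norm \<zeta> < \<delta> \<Longrightarrow>
      (X (z, of_real x + \<i> * G x z \<zeta>) + A (\<zeta>, of_real x - \<i> * G x z \<zeta>))\<^sup>2
      + (Y (z, of_real x + \<i> * G x z \<zeta>) + B (\<zeta>, of_real x - \<i> * G x z \<zeta>))\<^sup>2 = 4 * of_real \<epsilon> ^ 2"
      by (rule polarized[OF x]) blast
    show "\<exists>\<delta>>0. \<forall>\<zeta>. norm \<zeta> < \<delta> \<longrightarrow> ?f \<zeta> (of_real x) = 0"
      using \<delta>(3)[of 0] \<delta>(1,2) G_zero[OF x] by (intro exI[of _ \<delta>]) auto
  qed (use r in \<open>auto intro!: holomorphic_intros hol_slices\<close>)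
  then show ?thesis by simp
qed

text \<open>The coefficients of \<open>z\<close> and \<open>z\<^sup>2\<close> in the polarized
  equation. Along this slice \<open>w\<close> and \<open>\<omega>\<close> both move, so it is not a
  Segre variety, on which \<open>\<omega>\<close> is fixed; the derivatives \<open>a'\<close>,
  \<open>a''\<close>, \<open>b'\<close>, \<open>b''\<close> that enter for this reason are
  eliminated later. Among the coefficients of the series only the second row occurs, through
  \<open>n\<close>.\<close>

lemma leaf_coeffs:
  assumes u: "\<bar>u\<bar> < r / 2"
    and X12: "X1 holomorphic_on ball 0 (r / 2)" "X2 holomorphic_on ball 0 (r / 2)"
      "\<And>z w. norm z \<le> r / 4 \<Longrightarrow> norm w < r / 2 \<Longrightarrow>
       norm (X (z, w) - (X (0, w) + X1 w * z + X2 w * z\<^sup>2)) \<le> CX * norm z ^ 3"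
    and Y12: "Y1 holomorphic_on ball 0 (r / 2)" "Y2 holomorphic_on ball 0 (r / 2)"
      "\<And>z w. norm z \<le> r / 4 \<Longrightarrow> norm w < r / 2 \<Longrightarrow>
       norm (Y (z, w) - (Y (0, w) + Y1 w * z + Y2 w * z\<^sup>2)) \<le> CY * norm z ^ 3"
  obtains \<delta> n where "\<delta> > 0" "\<delta> \<le> s"
    "(\<And>l. l < 5 \<Longrightarrow> N 2 l u = 0) \<Longrightarrow> \<exists>D. \<forall>\<zeta>. norm \<zeta> \<le> s \<longrightarrow> norm (n \<zeta>) \<le> D * norm \<zeta> ^ 5"
    "\<And>\<zeta> x y x' y' x'' y'' a b a' b' a'' b''. norm \<zeta> < \<delta> \<Longrightarrow>
       x = X (0, of_real u) \<Longrightarrow> x' = deriv (\<lambda>w. X (0, w)) (of_real u) \<Longrightarrow> x'' = deriv (deriv (\<lambda>w. X (0, w))) (of_real u) / 2 \<Longrightarrow>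
       y = Y (0, of_real u) \<Longrightarrow> y' = deriv (\<lambda>w. Y (0, w)) (of_real u) \<Longrightarrow> y'' = deriv (deriv (\<lambda>w. Y (0, w))) (of_real u) / 2 \<Longrightarrow>
       a = A (\<zeta>, of_real u) \<Longrightarrow> a' = deriv (\<lambda>w. A (\<zeta>, w)) (of_real u) \<Longrightarrow> a'' = deriv (deriv (\<lambda>w. A (\<zeta>, w))) (of_real u) / 2 \<Longrightarrow>
       b = B (\<zeta>, of_real u) \<Longrightarrow> b' = deriv (\<lambda>w. B (\<zeta>, w)) (of_real u) \<Longrightarrow> b'' = deriv (deriv (\<lambda>w. B (\<zeta>, w))) (of_real u) / 2 \<Longrightarrow>
       (x + a) * (X1 (of_real u) + \<i> * \<zeta> * (x' - a')) + (y + b) * (Y1 (of_real u) + \<i> * \<zeta> * (y' - b')) = 0 \<and>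
       (X1 (of_real u) + \<i> * \<zeta> * (x' - a'))\<^sup>2 + 2 * (x + a) *
          (X2 (of_real u) + \<i> * \<zeta> * deriv X1 (of_real u) + (\<i> * \<zeta>)\<^sup>2 * (x'' + a'') + \<i> * n \<zeta> * (x' - a')) +
       ((Y1 (of_real u) + \<i> * \<zeta> * (y' - b'))\<^sup>2 + 2 * (y + b) *
          (Y2 (of_real u) + \<i> * \<zeta> * deriv Y1 (of_real u) + (\<i> * \<zeta>)\<^sup>2 * (y'' + b'') + \<i> * n \<zeta> * (y' - b'))) = 0"
proof -
  have ur: "\<bar>u\<bar> < r" and nu: "norm (complex_of_real u) < r / 2" using u r by auto
  obtain \<delta> where \<delta>: "\<delta> > 0" "\<delta> \<le> s" and pol: "\<And>z \<zeta>. norm z < \<delta> \<Longrightarrow> norm \<zeta> < \<delta> \<Longrightarrow>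
      (X (z, of_real u + \<i> * G u z \<zeta>) + A (\<zeta>, of_real u - \<i> * G u z \<zeta>))\<^sup>2
      + (Y (z, of_real u + \<i> * G u z \<zeta>) + B (\<zeta>, of_real u - \<i> * G u z \<zeta>))\<^sup>2 = 4 * of_real \<epsilon> ^ 2"
    by (rule polarized[OF ur]) blast
  obtain n C where n: "\<And>z \<zeta>. norm z \<le> s \<Longrightarrow> norm \<zeta> \<le> s \<Longrightarrow> norm (dser (\<lambda>k l. N k l u) z \<zeta> - n \<zeta> * z\<^sup>2) \<le> C * norm z ^ 3"
    and nm: "\<And>m. (\<And>l. l < m \<Longrightarrow> N 2 l u = 0) \<Longrightarrow> \<exists>D. \<forall>\<zeta>. norm \<zeta> \<le> s \<longrightarrow> norm (n \<zeta>) \<le> D * norm \<zeta> ^ m"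
    by (rule dser_row2[OF Nsum[OF ur] s(1)]) (use N0 in auto)
  show ?thesis
  proof (rule that[OF \<delta> nm])
    fix \<zeta> x y x' y' x'' y'' a b a' b' a'' b''
    assume \<zeta>: "norm \<zeta> < \<delta>"
      and xs: "x = X (0, of_real u)" "x' = deriv (\<lambda>w. X (0, w)) (of_real u)" "x'' = deriv (deriv (\<lambda>w. X (0, w))) (of_real u) / 2"
        "y = Y (0, of_real u)" "y' = deriv (\<lambda>w. Y (0, w)) (of_real u)" "y'' = deriv (deriv (\<lambda>w. Y (0, w))) (of_real u) / 2"
        "a = A (\<zeta>, of_real u)" "a' = deriv (\<lambda>w. A (\<zeta>, w)) (of_real u)" "a'' = deriv (deriv (\<lambda>w. A (\<zeta>, w))) (of_real u) / 2"
        "b = B (\<zeta>, of_real u)" "b' = deriv (\<lambda>w. B (\<zeta>, w)) (of_real u)" "b'' = deriv (deriv (\<lambda>w. B (\<zeta>, w))) (of_real u) / 2"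
    have evs: "eventually (\<lambda>z. z \<in> ball 0 \<delta>) (nhds (0::complex))"
      using \<delta> by (intro eventually_nhds_in_open) auto
    have "taylor2 (\<lambda>z. z * \<zeta> + n \<zeta> * (z * z)) 0 \<zeta> (n \<zeta>)"
      using taylor2_add[OF taylor2_mult[OF taylor2_id taylor2_const[of \<zeta>]]
        taylor2_mult[OF taylor2_const[of "n \<zeta>"] taylor2_mult[OF taylor2_id taylor2_id]]] by simp
    moreover have "(\<lambda>z. G u z \<zeta> - (z * \<zeta> + n \<zeta> * (z * z))) \<in> O[nhds 0](\<lambda>z. z ^ 3)"
    proof (rule bigoI)
      show "\<forall>\<^sub>F z in nhds 0. norm (G u z \<zeta> - (z * \<zeta> + n \<zeta> * (z * z))) \<le> C * norm (z ^ 3)"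
        using evs
      proof eventually_elim
        case (elim z)
        then show ?case using n[of z \<zeta>] \<delta> \<zeta> by (simp add: G_def power2_eq_square norm_power)
      qed
    qed
    ultimately have TG: "taylor2 (\<lambda>z. G u z \<zeta>) 0 \<zeta> (n \<zeta>)" by (rule taylor2_cong_bigo)
    have Tp: "taylor2 (\<lambda>z. of_real u + \<i> * G u z \<zeta>) (of_real u) (\<i> * \<zeta>) (\<i> * n \<zeta>)"
      using taylor2_add[OF taylor2_const[of "of_real u"] taylor2_mult[OF taylor2_const[of \<i>] TG]] by simp
    have Tm: "taylor2 (\<lambda>z. of_real u - \<i> * G u z \<zeta>) (of_real u) (- (\<i> * \<zeta>)) (- (\<i> * n \<zeta>))"
      using taylor2_add[OF taylor2_const[of "of_real u"] taylor2_mult[OF taylor2_const[of "-\<i>"] TG]] by simp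
    have TX: "taylor2 (\<lambda>z. X (z, of_real u + \<i> * G u z \<zeta>)) x (x' * (\<i> * \<zeta>) + X1 (of_real u))
       (x' * (\<i> * n \<zeta>) + x'' * (\<i> * \<zeta>)\<^sup>2 + deriv X1 (of_real u) * (\<i> * \<zeta>) + X2 (of_real u))"
      unfolding xs by (rule taylor2_hol2[OF X r X12 Tp nu])
    have TY: "taylor2 (\<lambda>z. Y (z, of_real u + \<i> * G u z \<zeta>)) y (y' * (\<i> * \<zeta>) + Y1 (of_real u))
       (y' * (\<i> * n \<zeta>) + y'' * (\<i> * \<zeta>)\<^sup>2 + deriv Y1 (of_real u) * (\<i> * \<zeta>) + Y2 (of_real u))"
      unfolding xs by (rule taylor2_hol2[OF Y r Y12 Tp nu])
    have \<zeta>r: "norm \<zeta> < r" using \<zeta> \<delta> s by simp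
    have sub: "ball (complex_of_real u) (r / 2) \<subseteq> ball 0 r"
    proof
      fix t assume "t \<in> ball (complex_of_real u) (r / 2)"
      then show "t \<in> ball 0 r"
        using norm_triangle_sub[of t "of_real u"] nu by (simp add: dist_norm norm_minus_commute)
    qed
    have r2: "r / 2 > 0" using r by simp
    have TA: "taylor2 (\<lambda>z. A (\<zeta>, of_real u - \<i> * G u z \<zeta>)) a (a' * (- (\<i> * \<zeta>))) (a' * (- (\<i> * n \<zeta>)) + a'' * (- (\<i> * \<zeta>))\<^sup>2)"
      unfolding xs by (rule taylor2_compose[OF Tm holomorphic_on_subset[OF hol_slices(3)[OF \<zeta>r] sub] r2])
    have TB: "taylor2 (\<lambda>z. B (\<zeta>, of_real u - \<i> * G u z \<zeta>)) b (b' * (- (\<i> * \<zeta>))) (b' * (- (\<i> * n \<zeta>)) + b'' * (- (\<i> * \<zeta>))\<^sup>2)"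
      unfolding xs by (rule taylor2_compose[OF Tm holomorphic_on_subset[OF hol_slices(4)[OF \<zeta>r] sub] r2])
    note TXA = taylor2_add[OF TX TA]
    note TYB = taylor2_add[OF TY TB]
    note T = taylor2_add[OF taylor2_add[OF taylor2_mult[OF TXA TXA] taylor2_mult[OF TYB TYB]]
        taylor2_const[of "- (4 * of_real \<epsilon> ^ 2)"]]
    have ev: "eventually (\<lambda>z. (X (z, of_real u + \<i> * G u z \<zeta>) + A (\<zeta>, of_real u - \<i> * G u z \<zeta>)) *
       (X (z, of_real u + \<i> * G u z \<zeta>) + A (\<zeta>, of_real u - \<i> * G u z \<zeta>)) +
      (Y (z, of_real u + \<i> * G u z \<zeta>) + B (\<zeta>, of_real u - \<i> * G u z \<zeta>)) *
      (Y (z, of_real u + \<i> * G u z \<zeta>) + B (\<zeta>, of_real u - \<i> * G u z \<zeta>)) + - (4 * of_real \<epsilon> ^ 2) = 0) (nhds 0)"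
      using evs by eventually_elim (use pol \<zeta> in \<open>simp add: power2_eq_square\<close>)
    define j where "j = \<i> * \<zeta>"
    define m where "m = \<i> * n \<zeta>"
    note e = taylor2_zero(2,3)[OF T ev]
    have jm: "\<i> * \<zeta> = j" "\<i> * n \<zeta> = m" by (auto simp: j_def m_def)
    have "2 * ((x + a) * (X1 (of_real u) + j * (x' - a')) + (y + b) * (Y1 (of_real u) + j * (y' - b'))) = 0"
      using e(1) unfolding jm by (simp add: algebra_simps)
    then have "(x + a) * (X1 (of_real u) + j * (x' - a')) + (y + b) * (Y1 (of_real u) + j * (y' - b')) = 0"
      by (metis mult_eq_0_iff zero_neq_numeral)
    moreover have "(X1 (of_real u) + j * (x' - a'))\<^sup>2 + 2 * (x + a) *
          (X2 (of_real u) + j * deriv X1 (of_real u) + j\<^sup>2 * (x'' + a'') + m * (x' - a')) +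
       ((Y1 (of_real u) + j * (y' - b'))\<^sup>2 + 2 * (y + b) *
          (Y2 (of_real u) + j * deriv Y1 (of_real u) + j\<^sup>2 * (y'' + b'') + m * (y' - b'))) = 0"
      using e(2) unfolding jm by (simp add: algebra_simps power2_eq_square)
    ultimately show "(x + a) * (X1 (of_real u) + \<i> * \<zeta> * (x' - a')) + (y + b) * (Y1 (of_real u) + \<i> * \<zeta> * (y' - b')) = 0 \<and>
       (X1 (of_real u) + \<i> * \<zeta> * (x' - a'))\<^sup>2 + 2 * (x + a) *
          (X2 (of_real u) + \<i> * \<zeta> * deriv X1 (of_real u) + (\<i> * \<zeta>)\<^sup>2 * (x'' + a'') + \<i> * n \<zeta> * (x' - a')) +
       ((Y1 (of_real u) + \<i> * \<zeta> * (y' - b'))\<^sup>2 + 2 * (y + b) *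
          (Y2 (of_real u) + \<i> * \<zeta> * deriv Y1 (of_real u) + (\<i> * \<zeta>)\<^sup>2 * (y'' + b'') + \<i> * n \<zeta> * (y' - b'))) = 0"
      unfolding jm by (intro conjI)
  qed
qed

section \<open>The curvature identity and the Jacobian determinant\<close>

lemma det_eq_zero:
  assumes DX: "(X has_derivative (\<lambda>v. x10 * fst v + x01 * snd v)) (at (0, 0))"
    and DY: "(Y has_derivative (\<lambda>v. y10 * fst v + y01 * snd v)) (at (0, 0))"
  shows "x10 * y01 = x01 * y10"
proof (rule ccontr)
  assume det: "x10 * y01 \<noteq> x01 * y10"
  obtain X1 X2 CX where X12: "X1 holomorphic_on ball 0 (r / 2)" "X2 holomorphic_on ball 0 (r / 2)"
      "\<And>w. X1 w = deriv (\<lambda>z. X (z, w)) 0"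
      "\<And>z w. norm z \<le> r / 4 \<Longrightarrow> norm w < r / 2 \<Longrightarrow>
       norm (X (z, w) - (X (0, w) + X1 w * z + X2 w * z\<^sup>2)) \<le> CX * norm z ^ 3"
    using hol2_taylor[OF X r] by blast
  obtain Y1 Y2 CY where Y12: "Y1 holomorphic_on ball 0 (r / 2)" "Y2 holomorphic_on ball 0 (r / 2)"
      "\<And>w. Y1 w = deriv (\<lambda>z. Y (z, w)) 0"
      "\<And>z w. norm z \<le> r / 4 \<Longrightarrow> norm w < r / 2 \<Longrightarrow>
       norm (Y (z, w) - (Y (0, w) + Y1 w * z + Y2 w * z\<^sup>2)) \<le> CY * norm z ^ 3"
    using hol2_taylor[OF Y r] by blast
  have partials: "deriv (\<lambda>z. f (z, 0)) 0 = p" "deriv (\<lambda>w. f (0, w)) 0 = q"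
    if "(f has_derivative (\<lambda>v. p * fst v + q * snd v)) (at (0, 0))" for f :: "complex \<times> complex \<Rightarrow> complex" and p q
  proof -
    have 1: "((\<lambda>z::complex. (z, 0::complex)) has_derivative (\<lambda>h. (h, 0))) (at 0)"
      "((\<lambda>z::complex. (0::complex, z)) has_derivative (\<lambda>h. (0, h))) (at 0)"
      by (intro has_derivative_Pair has_derivative_ident has_derivative_const)+
    have "((\<lambda>z. f (z, 0)) has_field_derivative p) (at 0)" "((\<lambda>z. f (0, z)) has_field_derivative q) (at 0)"
      using has_derivative_compose[OF 1(1), of f] has_derivative_compose[OF 1(2), of f] that
      unfolding has_field_derivative_def by fastforce+
    then show "deriv (\<lambda>z. f (z, 0)) 0 = p" "deriv (\<lambda>w. f (0, w)) 0 = q"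
      by (auto intro: DERIV_imp_deriv)
  qed
  define X0' Y0' where "X0' = deriv (\<lambda>w. X (0, w))" and "Y0' = deriv (\<lambda>w. Y (0, w))"
  have x: "X1 0 = x10" "X0' 0 = x01" and y: "Y1 0 = y10" "Y0' 0 = y01"
    using partials[OF DX] partials[OF DY] by (auto simp: X12 Y12 X0'_def Y0'_def)
  have r2: "r / 2 > 0" using r by simp
  have hX0': "X0' holomorphic_on ball 0 r" "Y0' holomorphic_on ball 0 r"
    unfolding X0'_def Y0'_def using r by (auto intro!: holomorphic_deriv hol_slices)
  have sub: "ball 0 (r / 2) \<subseteq> ball (0::complex) r" using r by auto
  \<comment> \<open>Half the derivative in \<open>u\<close> of the identity
    \<open>leaf_at_zero\<close>.\<close>
  have dB: "(X (0, u) + A (\<zeta>, u)) * (X0' u + deriv (\<lambda>w. A (\<zeta>, w)) u)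
      + (Y (0, u) + B (\<zeta>, u)) * (Y0' u + deriv (\<lambda>w. B (\<zeta>, w)) u) = 0"
    if \<zeta>: "norm \<zeta> < r" and u: "norm u < r" for \<zeta> u
  proof -
    have d: "((\<lambda>u. X (0, u)) has_field_derivative X0' u) (at u)"
      "((\<lambda>u. Y (0, u)) has_field_derivative Y0' u) (at u)"
      "((\<lambda>u. A (\<zeta>, u)) has_field_derivative deriv (\<lambda>w. A (\<zeta>, w)) u) (at u)"
      "((\<lambda>u. B (\<zeta>, u)) has_field_derivative deriv (\<lambda>w. B (\<zeta>, w)) u) (at u)"
      unfolding X0'_def Y0'_def
      by (rule holomorphic_derivI[of _ "ball 0 r"]; use \<zeta> u r in \<open>auto intro!: hol_slices\<close>)+
    have "((\<lambda>u. (X (0, u) + A (\<zeta>, u))\<^sup>2 + (Y (0, u) + B (\<zeta>, u))\<^sup>2) has_field_derivative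
       2 * ((X (0, u) + A (\<zeta>, u)) * (X0' u + deriv (\<lambda>w. A (\<zeta>, w)) u)
      + (Y (0, u) + B (\<zeta>, u)) * (Y0' u + deriv (\<lambda>w. B (\<zeta>, w)) u))) (at u)"
      by (auto intro!: derivative_eq_intros d simp: algebra_simps)
    then have "((\<lambda>u. 4 * of_real \<epsilon> ^ 2) has_field_derivative
       2 * ((X (0, u) + A (\<zeta>, u)) * (X0' u + deriv (\<lambda>w. A (\<zeta>, w)) u)
      + (Y (0, u) + B (\<zeta>, u)) * (Y0' u + deriv (\<lambda>w. B (\<zeta>, w)) u))) (at u)"
      by (rule has_field_derivative_transform_within_open[of _ _ _ "ball 0 r"])
         (use u \<zeta> leaf_at_zero in auto)
    then have "2 * ((X (0, u) + A (\<zeta>, u)) * (X0' u + deriv (\<lambda>w. A (\<zeta>, w)) u)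
      + (Y (0, u) + B (\<zeta>, u)) * (Y0' u + deriv (\<lambda>w. B (\<zeta>, w)) u)) = 0"
      by (rule DERIV_unique) (rule DERIV_const)
    then show ?thesis by (metis mult_eq_0_iff zero_neq_numeral)
  qed
  \<comment> \<open>\<open>X1 + 2 \<i> \<zeta> X0'\<close> is the derivative of \<open>X\<close> along \<open>w = u + 2 \<i> \<zeta> z\<close>: the radius is normal to the circle.\<close>
  have slope: "(X (0, u) + A (\<zeta>, u)) * (X1 u + 2 * \<i> * \<zeta> * X0' u)
      + (Y (0, u) + B (\<zeta>, u)) * (Y1 u + 2 * \<i> * \<zeta> * Y0' u) = 0"
    if "norm \<zeta> < r" "norm u < r / 2" for \<zeta> u
  proof (rule continuation[where f = "\<lambda>\<zeta> u. (X (0, u) + A (\<zeta>, u)) * (X1 u + 2 * \<i> * \<zeta> * X0' u)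
      + (Y (0, u) + B (\<zeta>, u)) * (Y1 u + 2 * \<i> * \<zeta> * Y0' u)", OF _ _ r2 _ that])
    fix x :: real assume x: "\<bar>x\<bar> < r / 2"
    obtain \<delta> n where \<delta>: "\<delta> > 0" "\<delta> \<le> s" and
      c1: "\<And>\<zeta>. norm \<zeta> < \<delta> \<Longrightarrow> (X (0, of_real x) + A (\<zeta>, of_real x)) * (X1 (of_real x) + \<i> * \<zeta> * (X0' (of_real x) - deriv (\<lambda>w. A (\<zeta>, w)) (of_real x)))
         + (Y (0, of_real x) + B (\<zeta>, of_real x)) * (Y1 (of_real x) + \<i> * \<zeta> * (Y0' (of_real x) - deriv (\<lambda>w. B (\<zeta>, w)) (of_real x))) = 0"
      unfolding X0'_def Y0'_def using leaf_coeffs[OF x X12(1,2,4) Y12(1,2,4)] by metis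
    show "\<exists>\<delta>>0. \<forall>\<zeta>. norm \<zeta> < \<delta> \<longrightarrow> (X (0, of_real x) + A (\<zeta>, of_real x)) * (X1 (of_real x) + 2 * \<i> * \<zeta> * X0' (of_real x))
      + (Y (0, of_real x) + B (\<zeta>, of_real x)) * (Y1 (of_real x) + 2 * \<i> * \<zeta> * Y0' (of_real x)) = 0"
    proof (intro exI[of _ \<delta>] conjI allI impI \<delta>)
      fix \<zeta> :: complex assume \<zeta>: "norm \<zeta> < \<delta>"
      have 1: "norm \<zeta> < r" "norm (complex_of_real x) < r" using \<zeta> \<delta> s x r by auto
      \<comment> \<open>Adding \<open>\<i> * \<zeta>\<close> times \<open>dB\<close> to the linear
        coefficient cancels the derivatives of \<open>A\<close> and \<open>B\<close> and doubles
        those of \<open>X\<close> and \<open>Y\<close>, which produces the slope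
        \<open>2 * \<i> * \<zeta>\<close>.\<close>
      have comb: "P * (p + 2 * \<i> * \<zeta> * q) + P' * (p' + 2 * \<i> * \<zeta> * q') = 0"
        if "P * (q + t) + P' * (q' + t') = 0" "P * (p + \<i> * \<zeta> * (q - t)) + P' * (p' + \<i> * \<zeta> * (q' - t')) = 0" for P P' p q t p' q' t'
      proof -
        have "P * (p + 2 * \<i> * \<zeta> * q) + P' * (p' + 2 * \<i> * \<zeta> * q') =
          (P * (p + \<i> * \<zeta> * (q - t)) + P' * (p' + \<i> * \<zeta> * (q' - t'))) + \<i> * \<zeta> * (P * (q + t) + P' * (q' + t'))"
          by (simp add: algebra_simps)
        then show ?thesis using that by simp
      qed
      show "(X (0, of_real x) + A (\<zeta>, of_real x)) * (X1 (of_real x) + 2 * \<i> * \<zeta> * X0' (of_real x))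
      + (Y (0, of_real x) + B (\<zeta>, of_real x)) * (Y1 (of_real x) + 2 * \<i> * \<zeta> * Y0' (of_real x)) = 0"
        by (rule comb[OF dB[OF 1] c1[OF \<zeta>]])
    qed
  next
    fix u :: complex assume "norm u < r / 2"
    then show "(\<lambda>\<zeta>. (X (0, u) + A (\<zeta>, u)) * (X1 u + 2 * \<i> * \<zeta> * X0' u)
      + (Y (0, u) + B (\<zeta>, u)) * (Y1 u + 2 * \<i> * \<zeta> * Y0' u)) holomorphic_on ball 0 r"
      using r by (intro holomorphic_intros hol_slices) auto
  next
    fix \<zeta> :: complex assume "norm \<zeta> < r"
    then show "(\<lambda>u. (X (0, u) + A (\<zeta>, u)) * (X1 u + 2 * \<i> * \<zeta> * X0' u)
      + (Y (0, u) + B (\<zeta>, u)) * (Y1 u + 2 * \<i> * \<zeta> * Y0' u)) holomorphic_on ball 0 (r / 2)"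
      using r by (intro holomorphic_intros X12 Y12 holomorphic_on_subset[OF hX0'(1) sub] holomorphic_on_subset[OF hX0'(2) sub]
         holomorphic_on_subset[OF hol_slices(1) sub] holomorphic_on_subset[OF hol_slices(2) sub]
         holomorphic_on_subset[OF hol_slices(3) sub] holomorphic_on_subset[OF hol_slices(4) sub]) auto
  qed
  define x02 y02 x11 y11 x20 y20 where "x02 = deriv X0' 0 / 2" and "y02 = deriv Y0' 0 / 2" and
    "x11 = deriv X1 0" and "y11 = deriv Y1 0" and "x20 = X2 0" and "y20 = Y2 0"
  have 00: "\<bar>0::real\<bar> < r / 2" using r by simp
  \<comment> \<open>The quadratic coefficient is taken at \<open>u = 0\<close>, where
    \<open>X\<close> and \<open>Y\<close> vanish and \<open>N 2 4\<close> is known to be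
    zero.\<close>
  obtain \<delta> n where \<delta>: "\<delta> > 0" "\<delta> \<le> s" and
     n5: "(\<And>l. l < 5 \<Longrightarrow> N 2 l 0 = 0) \<Longrightarrow> \<exists>D. \<forall>\<zeta>. norm \<zeta> \<le> s \<longrightarrow> norm (n \<zeta>) \<le> D * norm \<zeta> ^ 5" and
     c2: "\<And>\<zeta> a b a' b' a'' b''. norm \<zeta> < \<delta> \<Longrightarrow>
       a = A (\<zeta>, 0) \<Longrightarrow> a' = deriv (\<lambda>w. A (\<zeta>, w)) 0 \<Longrightarrow> a'' = deriv (deriv (\<lambda>w. A (\<zeta>, w))) 0 / 2 \<Longrightarrow>
       b = B (\<zeta>, 0) \<Longrightarrow> b' = deriv (\<lambda>w. B (\<zeta>, w)) 0 \<Longrightarrow> b'' = deriv (deriv (\<lambda>w. B (\<zeta>, w))) 0 / 2 \<Longrightarrow>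
       (x10 + \<i> * \<zeta> * (x01 - a'))\<^sup>2 + 2 * a *
          (x20 + \<i> * \<zeta> * x11 + (\<i> * \<zeta>)\<^sup>2 * (x02 + a'') + \<i> * n \<zeta> * (x01 - a')) +
       ((y10 + \<i> * \<zeta> * (y01 - b'))\<^sup>2 + 2 * b *
          (y20 + \<i> * \<zeta> * y11 + (\<i> * \<zeta>)\<^sup>2 * (y02 + b'') + \<i> * n \<zeta> * (y01 - b'))) = 0"
  proof (rule leaf_coeffs[OF 00 X12(1,2,4) Y12(1,2,4)])
    fix \<delta> :: real and n :: "complex \<Rightarrow> complex"
    assume \<delta>: "\<delta> > 0" "\<delta> \<le> s" and n5: "(\<And>l. l < 5 \<Longrightarrow> N 2 l 0 = 0) \<Longrightarrow> \<exists>D. \<forall>\<zeta>. norm \<zeta> \<le> s \<longrightarrow> norm (n \<zeta>) \<le> D * norm \<zeta> ^ 5"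
    assume *: "\<And>\<zeta> x y x' y' x'' y'' a b a' b' a'' b''. norm \<zeta> < \<delta> \<Longrightarrow>
       x = X (0, of_real 0) \<Longrightarrow> x' = deriv (\<lambda>w. X (0, w)) (of_real 0) \<Longrightarrow> x'' = deriv (deriv (\<lambda>w. X (0, w))) (of_real 0) / 2 \<Longrightarrow>
       y = Y (0, of_real 0) \<Longrightarrow> y' = deriv (\<lambda>w. Y (0, w)) (of_real 0) \<Longrightarrow> y'' = deriv (deriv (\<lambda>w. Y (0, w))) (of_real 0) / 2 \<Longrightarrow>
       a = A (\<zeta>, of_real 0) \<Longrightarrow> a' = deriv (\<lambda>w. A (\<zeta>, w)) (of_real 0) \<Longrightarrow> a'' = deriv (deriv (\<lambda>w. A (\<zeta>, w))) (of_real 0) / 2 \<Longrightarrow>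
       b = B (\<zeta>, of_real 0) \<Longrightarrow> b' = deriv (\<lambda>w. B (\<zeta>, w)) (of_real 0) \<Longrightarrow> b'' = deriv (deriv (\<lambda>w. B (\<zeta>, w))) (of_real 0) / 2 \<Longrightarrow>
       (x + a) * (X1 (of_real 0) + \<i> * \<zeta> * (x' - a')) + (y + b) * (Y1 (of_real 0) + \<i> * \<zeta> * (y' - b')) = 0 \<and>
       (X1 (of_real 0) + \<i> * \<zeta> * (x' - a'))\<^sup>2 + 2 * (x + a) *
          (X2 (of_real 0) + \<i> * \<zeta> * deriv X1 (of_real 0) + (\<i> * \<zeta>)\<^sup>2 * (x'' + a'') + \<i> * n \<zeta> * (x' - a')) +
       ((Y1 (of_real 0) + \<i> * \<zeta> * (y' - b'))\<^sup>2 + 2 * (y + b) *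
          (Y2 (of_real 0) + \<i> * \<zeta> * deriv Y1 (of_real 0) + (\<i> * \<zeta>)\<^sup>2 * (y'' + b'') + \<i> * n \<zeta> * (y' - b'))) = 0"
    show thesis
    proof (rule that[OF \<delta> n5])
      fix \<zeta> a b a' b' a'' b''
      assume h: "norm \<zeta> < \<delta>" "a = A (\<zeta>, 0)" "a' = deriv (\<lambda>w. A (\<zeta>, w)) 0" "a'' = deriv (deriv (\<lambda>w. A (\<zeta>, w))) 0 / 2"
       "b = B (\<zeta>, 0)" "b' = deriv (\<lambda>w. B (\<zeta>, w)) 0" "b'' = deriv (deriv (\<lambda>w. B (\<zeta>, w))) 0 / 2"
      show "(x10 + \<i> * \<zeta> * (x01 - a'))\<^sup>2 + 2 * a *
          (x20 + \<i> * \<zeta> * x11 + (\<i> * \<zeta>)\<^sup>2 * (x02 + a'') + \<i> * n \<zeta> * (x01 - a')) +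
       ((y10 + \<i> * \<zeta> * (y01 - b'))\<^sup>2 + 2 * b *
          (y20 + \<i> * \<zeta> * y11 + (\<i> * \<zeta>)\<^sup>2 * (y02 + b'') + \<i> * n \<zeta> * (y01 - b'))) = 0"
        using conjunct2[OF *[of \<zeta> 0 x01 x02 0 y01 y02 a a' a'' b b' b'']] h x y
        by (simp only: of_real_0 X0 Y0 add_0 x20_def y20_def x11_def y11_def x02_def y02_def X0'_def Y0'_def)
    qed
  qed
  \<comment> \<open>The cases \<open>l < 2\<close> and \<open>l = 2, 3\<close> come from the normal
    form; \<open>l = 4\<close> is the umbilicity of the point.\<close>
  have "N 2 l 0 = 0" if "l < 5" for l
  proof -
    have "l < 2 \<or> l = 2 \<or> l = 3 \<or> l = 4" using that by auto
    then show ?thesis using N0 N2 by auto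
  qed
  then obtain D where D: "\<And>\<zeta>. norm \<zeta> \<le> s \<Longrightarrow> norm (n \<zeta>) \<le> D * norm \<zeta> ^ 5" using n5 by blast
  \<comment> \<open>Along the line \<open>w = 2 * j * z\<close>, \<open>Q\<close> is the squared
    speed of \<open>(X, Y)\<close> and \<open>q\<close> is, up to sign, half the numerator of its
    curvature. The term \<open>2 * m * z\<^sup>2\<close> of the Segre variety adds
    \<open>2 * m * \<Delta>\<close> to \<open>q\<close>.\<close>
  define q where "q = (\<lambda>j. (y10 + 2 * j * y01) * (x20 + 2 * j * x11 + 4 * j\<^sup>2 * x02)
      - (x10 + 2 * j * x01) * (y20 + 2 * j * y11 + 4 * j\<^sup>2 * y02))"
  define Q where "Q = (\<lambda>j. (x10 + 2 * j * x01)\<^sup>2 + (y10 + 2 * j * y01)\<^sup>2)"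
  define \<Delta> where "\<Delta> = y10 * x01 - x10 * y01"
  have key: "16 * of_real \<epsilon> ^ 2 * (q (\<i> * \<zeta>) + 2 * (\<i> * n \<zeta>) * \<Delta>)\<^sup>2 = Q (\<i> * \<zeta>) ^ 3" if \<zeta>: "norm \<zeta> < \<delta>" for \<zeta>
  proof -
    have \<zeta>r: "norm \<zeta> < r" using \<zeta> \<delta> s by simp
    define a a' a'' b b' b'' where "a = A (\<zeta>, 0)" and "a' = deriv (\<lambda>w. A (\<zeta>, w)) 0" and "a'' = deriv (deriv (\<lambda>w. A (\<zeta>, w))) 0 / 2"
      and "b = B (\<zeta>, 0)" and "b' = deriv (\<lambda>w. B (\<zeta>, w)) 0" and "b'' = deriv (deriv (\<lambda>w. B (\<zeta>, w))) 0 / 2"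
    define j m where "j = \<i> * \<zeta>" and "m = \<i> * n \<zeta>"
    have TX: "taylor2 (\<lambda>u. X (0, u)) 0 x01 x02"
      using taylor2_holomorphic[OF hol_slices(1) r, of 0] r x by (simp add: X0 x02_def X0'_def)
    have TY: "taylor2 (\<lambda>u. Y (0, u)) 0 y01 y02"
      using taylor2_holomorphic[OF hol_slices(2) r, of 0] r y by (simp add: Y0 y02_def Y0'_def)
    have TA: "taylor2 (\<lambda>u. A (\<zeta>, u)) a a' a''"
      using taylor2_holomorphic[OF hol_slices(3)[OF \<zeta>r] r] by (simp add: a_def a'_def a''_def)
    have TB: "taylor2 (\<lambda>u. B (\<zeta>, u)) b b' b''"
      using taylor2_holomorphic[OF hol_slices(4)[OF \<zeta>r] r] by (simp add: b_def b'_def b''_def)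
    have TX1: "taylor2 X1 x10 x11 (deriv (deriv X1) 0 / 2)" "taylor2 Y1 y10 y11 (deriv (deriv Y1) 0 / 2)"
      using taylor2_holomorphic[OF X12(1) r2] taylor2_holomorphic[OF Y12(1) r2] x y by (simp_all add: x11_def y11_def)
    have TX0': "taylor2 X0' x01 (2 * x02) (deriv (deriv X0') 0 / 2)" "taylor2 Y0' y01 (2 * y02) (deriv (deriv Y0') 0 / 2)"
      using taylor2_holomorphic[OF hX0'(1) r] taylor2_holomorphic[OF hX0'(2) r] x y by (simp_all add: x02_def y02_def)
    note TXA = taylor2_add[OF TX TA]
    note TYB = taylor2_add[OF TY TB]
    have evr: "eventually (\<lambda>u. u \<in> ball 0 (r / 2)) (nhds (0::complex))"
      using r by (intro eventually_nhds_in_open) auto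
    have ev1: "eventually (\<lambda>u. (X (0, u) + A (\<zeta>, u)) * (X (0, u) + A (\<zeta>, u)) + (Y (0, u) + B (\<zeta>, u)) * (Y (0, u) + B (\<zeta>, u))
        + - (4 * of_real \<epsilon> ^ 2) = 0) (nhds 0)"
      using evr
    proof eventually_elim
      case (elim u)
      then show ?case using leaf_at_zero[OF \<zeta>r, of u] r by (simp add: power2_eq_square)
    qed
    \<comment> \<open>The 2-jet in \<open>u\<close> of the leaf identity; its coefficients become
      \<open>E0\<close>, \<open>E1\<close>, \<open>E2\<close>.\<close>
    note z1 = taylor2_zero[OF taylor2_add[OF taylor2_add[OF taylor2_mult[OF TXA TXA] taylor2_mult[OF TYB TYB]]
        taylor2_const[of "- (4 * of_real \<epsilon> ^ 2)"]] ev1]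
    have E0: "a\<^sup>2 + b\<^sup>2 = 4 * of_real \<epsilon> ^ 2" using z1(1) by (simp add: power2_eq_square)
    have "2 * (a * (x01 + a') + b * (y01 + b')) = 0" using z1(2) by (simp add: algebra_simps)
    then have E1: "a * (x01 + a') + b * (y01 + b') = 0" by (metis mult_eq_0_iff zero_neq_numeral)
    have E2: "(x01 + a')\<^sup>2 + 2 * a * (x02 + a'') + ((y01 + b')\<^sup>2 + 2 * b * (y02 + b'')) = 0"
      using z1(3) by (simp add: power2_eq_square algebra_simps)
    have ev2: "eventually (\<lambda>u. (X (0, u) + A (\<zeta>, u)) * (X1 u + (2 * j) * X0' u)
      + (Y (0, u) + B (\<zeta>, u)) * (Y1 u + (2 * j) * Y0' u) = 0) (nhds 0)"
      using evr
    proof eventually_elim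
      case (elim u)
      then show ?case using slope[OF \<zeta>r, of u] r by (simp add: j_def mult.assoc)
    qed
    \<comment> \<open>The jet in \<open>u\<close> of the slope identity, whose value and first
      derivative become \<open>F0\<close> and \<open>F1\<close>.\<close>
    note z2 = taylor2_zero[OF taylor2_add[OF taylor2_mult[OF TXA taylor2_add[OF TX1(1) taylor2_mult[OF taylor2_const[of "2 * j"] TX0'(1)]]]
        taylor2_mult[OF TYB taylor2_add[OF TX1(2) taylor2_mult[OF taylor2_const[of "2 * j"] TX0'(2)]]]] ev2]
    have F0: "a * (x10 + 2 * j * x01) + b * (y10 + 2 * j * y01) = 0" using z2(1) by simp
    have F1: "(x01 + a') * (x10 + 2 * j * x01) + a * (x11 + 4 * j * x02) + ((y01 + b') * (y10 + 2 * j * y01) + b * (y11 + 4 * j * y02)) = 0"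
      using z2(2) by (simp add: algebra_simps)
    have C2: "(x10 + j * (x01 - a'))\<^sup>2 + 2 * a * (x20 + j * x11 + j\<^sup>2 * (x02 + a'') + m * (x01 - a')) +
       ((y10 + j * (y01 - b'))\<^sup>2 + 2 * b * (y20 + j * y11 + j\<^sup>2 * (y02 + b'') + m * (y01 - b'))) = 0"
      unfolding j_def m_def by (rule c2[OF \<zeta> a_def a'_def a''_def b_def b'_def b''_def])
    define al be where "al = x20 + 2 * j * x11 + 4 * j\<^sup>2 * x02 + 2 * m * x01" and "be = y20 + 2 * j * y11 + 4 * j\<^sup>2 * y02 + 2 * m * y01"
    \<comment> \<open>The curvature equation of the circle along \<open>w = 2 j z + 2 m z\<^sup>2\<close>. The known identities live on
        the slice \<open>u = 0\<close> and on the leaf \<open>z = 0\<close>; this combination eliminates \<open>a', a'', b', b''\<close>.\<close>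
    have "Q j + 2 * (a * al + b * be) =
      ((x10 + j * (x01 - a'))\<^sup>2 + 2 * a * (x20 + j * x11 + j\<^sup>2 * (x02 + a'') + m * (x01 - a')) +
       ((y10 + j * (y01 - b'))\<^sup>2 + 2 * b * (y20 + j * y11 + j\<^sup>2 * (y02 + b'') + m * (y01 - b'))))
      + 2 * j * ((x01 + a') * (x10 + 2 * j * x01) + a * (x11 + 4 * j * x02) + ((y01 + b') * (y10 + 2 * j * y01) + b * (y11 + 4 * j * y02)))
      - j\<^sup>2 * ((x01 + a')\<^sup>2 + 2 * a * (x02 + a'') + ((y01 + b')\<^sup>2 + 2 * b * (y02 + b'')))
      + 2 * m * (a * (x01 + a') + b * (y01 + b'))"
      unfolding al_def be_def Q_def by (simp add: algebra_simps power2_eq_square)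
    then have W: "Q j + 2 * (a * al + b * be) = 0" unfolding C2 E1 E2 F1 by simp
    define p p' where "p = x10 + 2 * j * x01" and "p' = y10 + 2 * j * y01"
    have Qp: "Q j = p\<^sup>2 + p'\<^sup>2" by (simp add: Q_def p_def p'_def)
    have qd: "q j + 2 * m * \<Delta> = p' * al - p * be"
      by (simp add: q_def \<Delta>_def p_def p'_def al_def be_def algebra_simps power2_eq_square)
    \<comment> \<open>By \<open>F0\<close> the radius \<open>(a, b)\<close> is a multiple of
      \<open>(p', -p)\<close>, \<open>W\<close> determines the factor and \<open>E0\<close> fixes
      the radius as \<open>2 * \<epsilon>\<close>. The constant 16 is \<open>4 * 2\<^sup>2\<close>,
      where the 4 arises because \<open>al\<close> and \<open>be\<close> are halves of second
      derivatives.\<close>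
    have "16 * of_real \<epsilon> ^ 2 * (p' * al - p * be)\<^sup>2 = (p\<^sup>2 + p'\<^sup>2) ^ 3"
      using W[unfolded Qp] E0 F0[folded p_def p'_def] by algebra
    then show ?thesis by (simp add: Qp qd flip: j_def m_def)
  qed
  \<comment> \<open>The slope at \<open>\<zeta> = u = 0\<close> makes \<open>(x10, y10)\<close>
    orthogonal to the real vector \<open>(c, d)\<close>, whose square is
    \<open>\<epsilon>\<^sup>2 \<noteq> 0\<close>. An isotropic vector with this property is zero,
    which would make the determinant vanish.\<close>
  have Q0: "x10\<^sup>2 + y10\<^sup>2 \<noteq> 0"
  proof
    assume 0: "x10\<^sup>2 + y10\<^sup>2 = 0"
    have "(2 * of_real c) * x10 + (2 * of_real d) * y10 = 0"
      using slope[of 0 0] r x y by (simp add: X0 Y0 A_def B_def)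
    then have "of_real (c\<^sup>2 + d\<^sup>2) * x10\<^sup>2 = 0" "of_real (c\<^sup>2 + d\<^sup>2) * y10\<^sup>2 = 0"
      using 0 unfolding of_real_add of_real_power by algebra+
    then have "x10 = 0" "y10 = 0" using \<epsilon> by (auto simp: cd simp del: of_real_add)
    then show False using det by simp
  qed
  define q0 q1 q2 q3 where "q0 = y10 * x20 - x10 * y20" and
    "q1 = 2 * (y10 * x11 + y01 * x20 - x10 * y11 - x01 * y20)" and
    "q2 = 4 * (y10 * x02 + y01 * x11 - x10 * y02 - x01 * y11)" and "q3 = 8 * (y01 * x02 - x01 * y02)"
  have qe: "q j = q0 + q1 * j + q2 * j\<^sup>2 + q3 * j ^ 3" for j
    by (simp add: q_def q0_def q1_def q2_def q3_def algebra_simps power2_eq_square power3_eq_cube)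
  have Qe: "Q j = (x10\<^sup>2 + y10\<^sup>2) + 4 * (x10 * x01 + y10 * y01) * j + 4 * (x01\<^sup>2 + y01\<^sup>2) * j\<^sup>2" for j
    by (simp add: Q_def algebra_simps power2_eq_square)
  define \<kappa> where "\<kappa> = (16 * of_real \<epsilon> ^ 2 :: complex)"
  obtain K where K: "\<And>j. norm j \<le> 1 \<Longrightarrow> norm (4 * q j) \<le> K"
  proof -
    have "continuous_on (cball 0 1) (\<lambda>j. 4 * q j)" unfolding q_def by (intro continuous_intros)
    then have "bounded ((\<lambda>j. 4 * q j) ` cball 0 1)" by (intro compact_imp_bounded compact_continuous_image) auto
    then show ?thesis using that by (fastforce simp: bounded_iff)
  qed
  have K0: "0 \<le> K" using order_trans[OF norm_ge_zero K[of 0]] by simp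
  \<comment> \<open>The difference of the squares of \<open>q j\<close> and
    \<open>q j + 2 * m * \<Delta>\<close> is
    \<open>- (m * \<Delta> * (4 * q j + 4 * m * \<Delta>))\<close>. On the unit disc
    \<open>K\<close> bounds \<open>4 * q j\<close> and \<open>\<bar>D\<bar>\<close> bounds
    \<open>m\<close>, while the first factor \<open>m\<close> contributes
    \<open>norm j ^ 5\<close>.\<close>
  define C where "C = norm \<kappa> * (\<bar>D\<bar> * norm \<Delta> * (K + 4 * \<bar>D\<bar> * norm \<Delta>))"
  have "norm (\<kappa> * (q j)\<^sup>2 - Q j ^ 3) \<le> C * norm j ^ 5" if j: "norm j < \<delta>" "norm j \<le> 1" for j
  proof -
    define \<zeta> where "\<zeta> = - \<i> * j"
    have j\<zeta>: "j = \<i> * \<zeta>" "norm \<zeta> = norm j" by (simp_all add: \<zeta>_def norm_mult)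
    define m where "m = \<i> * n \<zeta>"
    have "norm (n \<zeta>) \<le> D * norm j ^ 5" using D[of \<zeta>] j \<delta> by (simp add: j\<zeta>(2))
    also have "\<dots> \<le> \<bar>D\<bar> * norm j ^ 5" by (intro mult_right_mono) auto
    finally have m: "norm m \<le> \<bar>D\<bar> * norm j ^ 5" by (simp add: m_def norm_mult)
    also have "\<dots> \<le> \<bar>D\<bar> * 1" using j by (intro mult_left_mono power_le_one) auto
    finally have m1: "norm m \<le> \<bar>D\<bar>" by simp
    have "\<kappa> * (q j + 2 * m * \<Delta>)\<^sup>2 = Q j ^ 3"
      using key[of \<zeta>] j by (simp add: \<kappa>_def m_def j\<zeta>(1)) (simp add: j\<zeta>(2) flip: j\<zeta>(1))
    then have "\<kappa> * (q j)\<^sup>2 - Q j ^ 3 = - (\<kappa> * (m * \<Delta> * (4 * q j + 4 * m * \<Delta>)))"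
      by (simp add: algebra_simps power2_eq_square)
    then have "norm (\<kappa> * (q j)\<^sup>2 - Q j ^ 3) = norm \<kappa> * (norm m * norm \<Delta> * norm (4 * q j + 4 * m * \<Delta>))"
      by (simp only: norm_minus_cancel norm_mult)
    also have "\<dots> \<le> norm \<kappa> * ((\<bar>D\<bar> * norm j ^ 5) * norm \<Delta> * (K + 4 * \<bar>D\<bar> * norm \<Delta>))"
    proof -
      have "norm (4 * q j + 4 * m * \<Delta>) \<le> norm (4 * q j) + norm (4 * m * \<Delta>)" by (rule norm_triangle_ineq)
      also have "\<dots> \<le> K + 4 * \<bar>D\<bar> * norm \<Delta>"
        unfolding norm_mult[of "4 * m"] norm_mult[of 4 m]
        using K[OF j(2)] m1 by (intro add_mono mult_right_mono) auto
      finally show ?thesis using m K0 by (intro mult_left_mono mult_mono) auto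
    qed
    finally show ?thesis by (simp add: C_def mult_ac)
  qed
  then have "eventually (\<lambda>j. norm (\<kappa> * (q j)\<^sup>2 - Q j ^ 3) \<le> C * norm j ^ 5) (at 0)"
    using \<delta> by (auto simp: eventually_at intro!: exI[of _ "min \<delta> 1"])
  \<comment> \<open>By Lagrange's identity \<open>4 * Q0 * Q2 - Q1\<^sup>2\<close> equals 16 times
    the squared determinant.\<close>
  from cube_of_quadratic_square_mod5[OF this[unfolded qe Qe] Q0]
  have "(x10 * y01 - x01 * y10)\<^sup>2 = 0" by algebra
  then show False using det by simp
qed

end

section \<open>The domain and its boundary\<close>

definition log_sq :: "complex \<times> complex \<Rightarrow> real" where
  "log_sq x = (ln (cmod (fst x)))\<^sup>2 + (ln (cmod (snd x)))\<^sup>2"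

definition off_axes :: "(complex \<times> complex) set" where
  "off_axes = {x. fst x \<noteq> 0 \<and> snd x \<noteq> 0}"

lemma open_off_axes: "open off_axes"
proof -
  have "off_axes = (- {0}) \<times> (- {0})" by (auto simp: off_axes_def)
  moreover have "open ((- {0::complex}) \<times> (- {0::complex}))"
    by (intro open_Times open_Compl closed_singleton)
  ultimately show ?thesis by simp
qed

lemma Deps_eq: "Deps \<epsilon> = {x \<in> off_axes. log_sq x < \<epsilon>\<^sup>2}"
  by (auto simp: Deps_def off_axes_def log_sq_def)

lemma continuous_on_log_sq: "continuous_on off_axes log_sq"
  unfolding log_sq_def off_axes_def by (intro continuous_intros) auto

lemma open_Deps: "open (Deps \<epsilon>)"
proof -
  have "open (off_axes \<inter> log_sq -` {..<\<epsilon>\<^sup>2})"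
    using continuous_on_log_sq open_off_axes by (intro continuous_open_preimage) auto
  then show ?thesis by (simp add: Deps_eq Int_def vimage_def)
qed

lemma cmod_bounds_of_log_sq:
  assumes "x \<in> off_axes" "log_sq x \<le> \<epsilon>\<^sup>2" "\<epsilon> > 0"
  shows "exp (- \<epsilon>) \<le> cmod (fst x)" "cmod (fst x) \<le> exp \<epsilon>" "exp (- \<epsilon>) \<le> cmod (snd x)" "cmod (snd x) \<le> exp \<epsilon>"
proof -
  have "(ln (cmod (fst x)))\<^sup>2 \<le> \<epsilon>\<^sup>2" "(ln (cmod (snd x)))\<^sup>2 \<le> \<epsilon>\<^sup>2"
    using assms(2) zero_le_power2[of "ln (cmod (fst x))"] zero_le_power2[of "ln (cmod (snd x))"]
    unfolding log_sq_def by linarith+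
  then have *: "\<bar>ln (cmod (fst x))\<bar> \<le> \<epsilon>" "\<bar>ln (cmod (snd x))\<bar> \<le> \<epsilon>"
    using assms(3) by (auto simp flip: abs_le_square_iff)
  have b: "exp (- \<epsilon>) \<le> t \<and> t \<le> exp \<epsilon>" if "\<bar>ln t\<bar> \<le> \<epsilon>" "t > 0" for t :: real
    using that exp_le_cancel_iff[of "-\<epsilon>" "ln t"] exp_le_cancel_iff[of "ln t" \<epsilon>] by auto
  show "exp (- \<epsilon>) \<le> cmod (fst x)" "cmod (fst x) \<le> exp \<epsilon>" "exp (- \<epsilon>) \<le> cmod (snd x)" "cmod (snd x) \<le> exp \<epsilon>"
    using b[OF *(1)] b[OF *(2)] assms(1) by (auto simp: off_axes_def)
qed

text \<open>\<open>log_sq\<close> is continuous off the axes only. The sublevel set lies in a closed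
  set of points with both moduli at least \<open>exp (- \<epsilon>)\<close>, and there it is a
  closed preimage.\<close>

lemma closed_log_sq_le:
  assumes "\<epsilon> > 0" shows "closed {x \<in> off_axes. log_sq x \<le> \<epsilon>\<^sup>2}"
proof -
  let ?K = "{x :: complex \<times> complex. exp (- \<epsilon>) \<le> cmod (fst x) \<and> exp (- \<epsilon>) \<le> cmod (snd x)}"
  have K: "closed ?K" by (intro closed_Collect_conj closed_Collect_le continuous_intros)
  have sub: "?K \<subseteq> off_axes"
  proof
    fix x :: "complex \<times> complex" assume "x \<in> ?K"
    then have "0 < cmod (fst x)" "0 < cmod (snd x)"
      by (auto intro: less_le_trans[OF exp_gt_zero])
    then show "x \<in> off_axes" by (simp add: off_axes_def)
  qed
  have "closed (?K \<inter> log_sq -` {..\<epsilon>\<^sup>2})"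
    by (intro continuous_closed_preimage continuous_on_subset[OF continuous_on_log_sq sub] K closed_atMost)
  moreover have "?K \<inter> log_sq -` {..\<epsilon>\<^sup>2} = {x \<in> off_axes. log_sq x \<le> \<epsilon>\<^sup>2}"
    using sub cmod_bounds_of_log_sq[OF _ _ assms] by auto
  ultimately show ?thesis by simp
qed

lemma log_sq_exp: "log_sq (exp x, exp y) = (Re x)\<^sup>2 + (Re y)\<^sup>2"
  by (simp add: log_sq_def)

text \<open>In logarithmic coordinates a point of the closed tube is the limit of its multiples by
  real \<open>t < 1\<close>, which lie in the open tube.\<close>

lemma closure_Deps:
  assumes "\<epsilon> > 0" shows "closure (Deps \<epsilon>) = {x \<in> off_axes. log_sq x \<le> \<epsilon>\<^sup>2}"
proof
  show "closure (Deps \<epsilon>) \<subseteq> {x \<in> off_axes. log_sq x \<le> \<epsilon>\<^sup>2}"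
    by (rule closure_minimal[OF _ closed_log_sq_le[OF assms]]) (auto simp: Deps_eq)
  show "{x \<in> off_axes. log_sq x \<le> \<epsilon>\<^sup>2} \<subseteq> closure (Deps \<epsilon>)"
  proof
    fix q assume q: "q \<in> {x \<in> off_axes. log_sq x \<le> \<epsilon>\<^sup>2}"
    define x y where "x = Ln (fst q)" and "y = Ln (snd q)"
    have qe: "q = (exp x, exp y)" using q by (simp add: x_def y_def off_axes_def)
    let ?g = "\<lambda>t::real. (exp (of_real t * x), exp (of_real t * y))"
    have "?g ` closure {0..<1} \<subseteq> closure (Deps \<epsilon>)"
    proof (rule image_closure_subset)
      show "continuous_on (closure {0..<1}) ?g" by (intro continuous_intros)
      show "?g ` {0..<1} \<subseteq> closure (Deps \<epsilon>)"
      proof safe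
        fix t :: real assume t: "t \<in> {0..<1}"
        have le: "(Re x)\<^sup>2 + (Re y)\<^sup>2 \<le> \<epsilon>\<^sup>2" using q log_sq_exp by (simp add: qe)
        have "(Re (of_real t * x))\<^sup>2 + (Re (of_real t * y))\<^sup>2 = t\<^sup>2 * ((Re x)\<^sup>2 + (Re y)\<^sup>2)"
          by (simp add: power_mult_distrib distrib_left)
        also have "\<dots> \<le> t\<^sup>2 * \<epsilon>\<^sup>2" using le by (intro mult_left_mono) auto
        also have "\<dots> < 1 * \<epsilon>\<^sup>2"
          using t assms by (intro mult_strict_right_mono) (auto simp: abs_square_less_1)
        finally have "?g t \<in> Deps \<epsilon>" by (simp add: Deps_eq off_axes_def log_sq_exp)
        then show "?g t \<in> closure (Deps \<epsilon>)" using closure_subset by blast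
      qed
    qed auto
    moreover have "q = ?g 1" "1 \<in> closure {0..<1::real}" by (auto simp: qe)
    ultimately show "q \<in> closure (Deps \<epsilon>)" by blast
  qed
qed

lemma frontier_Deps:
  assumes "\<epsilon> > 0" shows "frontier (Deps \<epsilon>) = {x \<in> off_axes. log_sq x = \<epsilon>\<^sup>2}"
  unfolding frontier_def closure_Deps[OF assms] interior_open[OF open_Deps] by (auto simp: Deps_eq)

lemma bounded_Deps:
  assumes "\<epsilon> > 0" shows "bounded (Deps \<epsilon>)"
proof (rule bounded_subset)
  show "bounded (cball (0::complex) (exp \<epsilon>) \<times> cball (0::complex) (exp \<epsilon>))"
    by (intro bounded_Times bounded_cball)
  show "Deps \<epsilon> \<subseteq> cball 0 (exp \<epsilon>) \<times> cball 0 (exp \<epsilon>)"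
    using cmod_bounds_of_log_sq[OF _ _ assms] by (auto simp: Deps_eq less_imp_le)
qed

text \<open>The domain is the image under the componentwise exponential of the tube over a disc,
  which is convex.\<close>

lemma connected_Deps: assumes "\<epsilon> > 0" shows "connected (Deps \<epsilon>)"
proof -
  let ?L = "\<lambda>x :: complex \<times> complex. (Re (fst x), Re (snd x))"
  let ?T = "?L -` ball 0 \<epsilon>"
  have "linear ?L" by (auto intro!: linearI)
  then have "convex ?T" by (intro convex_linear_vimage convex_ball)
  then have "connected ?T" by (rule convex_connected)
  moreover have "continuous_on ?T (\<lambda>x. (exp (fst x), exp (snd x)))" by (intro continuous_intros)
  ultimately have "connected ((\<lambda>x. (exp (fst x), exp (snd x))) ` ?T)" by (intro connected_continuous_image)
  moreover have T: "x \<in> ?T \<longleftrightarrow> (Re (fst x))\<^sup>2 + (Re (snd x))\<^sup>2 < \<epsilon>\<^sup>2" for x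
  proof -
    have "x \<in> ?T \<longleftrightarrow> sqrt ((Re (fst x))\<^sup>2 + (Re (snd x))\<^sup>2) < sqrt (\<epsilon>\<^sup>2)"
      using assms by (simp add: norm_Pair)
    then show ?thesis by (simp only: real_sqrt_less_iff)
  qed
  have "Deps \<epsilon> = (\<lambda>x. (exp (fst x), exp (snd x))) ` ?T"
  proof (rule set_eqI)
    fix q :: "complex \<times> complex"
    show "q \<in> Deps \<epsilon> \<longleftrightarrow> q \<in> (\<lambda>x. (exp (fst x), exp (snd x))) ` ?T"
    proof
      assume q: "q \<in> Deps \<epsilon>"
      then have "q = (exp (Ln (fst q)), exp (Ln (snd q)))" by (simp add: Deps_eq off_axes_def)
      moreover have "(Ln (fst q), Ln (snd q)) \<in> ?T"
        using q unfolding T by (simp add: Deps_eq off_axes_def log_sq_def)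
      ultimately show "q \<in> (\<lambda>x. (exp (fst x), exp (snd x))) ` ?T"
        by (metis (no_types, lifting) fst_conv snd_conv image_eqI)
    next
      assume "q \<in> (\<lambda>x. (exp (fst x), exp (snd x))) ` ?T"
      then show "q \<in> Deps \<epsilon>" unfolding image_iff Bex_def T by (auto simp: Deps_eq off_axes_def log_sq_exp)
    qed
  qed
  ultimately show ?thesis by simp
qed

section \<open>Derivatives and Levi form of the defining function\<close>

text \<open>The complex number \<open>lgrad z\<close> represents the differential of \<open>(ln |z|)\<^sup>2\<close> through the real inner product.\<close>

definition lgrad :: "complex \<Rightarrow> complex" where
  "lgrad z = (2 * ln (cmod z)) *\<^sub>R cnj (inverse z)"

text \<open>The derivative of \<open>lgrad\<close> at \<open>z\<close> in direction
  \<open>s\<close>, from the product rule; paired with \<open>s\<close> it gives the real Hessian of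
  \<open>(ln |z|)\<^sup>2\<close>.\<close>

definition lhess :: "complex \<Rightarrow> complex \<Rightarrow> complex" where
  "lhess z s = (2 * Re (s / z)) *\<^sub>R cnj (inverse z) - (2 * ln (cmod z)) *\<^sub>R cnj (s / z\<^sup>2)"

lemma has_derivative_ln_cmod:
  assumes "z \<noteq> 0" shows "((\<lambda>z. ln (cmod z)) has_derivative (\<lambda>s. Re (s / z))) (at z)"
proof -
  have "((\<lambda>z. ln (cmod z)) has_derivative (\<lambda>s. inner (sgn z) s * inverse (cmod z))) (at z)"
    using assms by (auto intro!: derivative_eq_intros has_derivative_norm[OF assms] simp: inner_commute)
  moreover have "inner (sgn z) s * inverse (cmod z) = Re (s / z)" for s
    using assms cmod_power2[of z]
    by (simp add: inner_complex_def sgn_div_norm Re_divide power2_eq_square field_simps)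
  ultimately show ?thesis by simp
qed

lemma has_derivative_ln_cmod_sq:
  assumes "z \<noteq> 0" shows "((\<lambda>z. (ln (cmod z))\<^sup>2) has_derivative (\<lambda>s. inner (lgrad z) s)) (at z)"
proof -
  have "((\<lambda>z. (ln (cmod z))\<^sup>2) has_derivative (\<lambda>s. 2 * ln (cmod z) * Re (s / z))) (at z)"
    using has_derivative_mult[OF has_derivative_ln_cmod[OF assms] has_derivative_ln_cmod[OF assms]]
    unfolding power2_eq_square by (rule has_derivative_eq_rhs) auto
  moreover have "2 * ln (cmod z) * Re (s / z) = inner (lgrad z) s" for s
    by (simp add: lgrad_def inner_complex_def divide_inverse algebra_simps)
  ultimately show ?thesis by simp
qed

lemma has_derivative_lgrad:
  assumes "z \<noteq> 0" shows "(lgrad has_derivative lhess z) (at z)"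
proof -
  have "((\<lambda>z. inverse z) has_derivative (\<lambda>s. - (s / z\<^sup>2))) (at z)"
    using assms by (auto intro!: derivative_eq_intros simp: divide_simps power2_eq_square)
  from has_derivative_scaleR[OF has_derivative_mult_right[OF has_derivative_ln_cmod[OF assms], of 2] has_derivative_cnj[OF this]]
  show ?thesis unfolding lgrad_def[abs_def] lhess_def
    by (rule has_derivative_eq_rhs) (auto simp: scaleR_conv_of_real algebra_simps)
qed

text \<open>The part containing \<open>ln |z|\<close> is a multiple of
  \<open>Re ((s / z)\<^sup>2)\<close>, which changes sign under \<open>s \<mapsto> \<i> * s\<close>
  because \<open>ln |z|\<close> is harmonic. The squares of the real and imaginary parts of
  \<open>s / z\<close> remain.\<close>

lemma lhess_levi:
  "inner (lhess z s) s + inner (lhess z (\<i> * s)) (\<i> * s) = 2 * (cmod (s / z))\<^sup>2"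
proof -
  have q: "inner (lhess z s) s = 2 * (Re (s / z))\<^sup>2 - 2 * ln (cmod z) * Re ((s / z)\<^sup>2)" for s
  proof -
    have i: "inner (cnj a) b = Re (b * a)" for a b by (simp add: inner_complex_def algebra_simps)
    show ?thesis unfolding lhess_def inner_diff_left inner_scaleR_left i
      by (simp add: divide_inverse power2_eq_square mult_ac)
  qed
  define v where "v = s / z"
  have i: "\<i> * s / z = \<i> * v" by (simp add: v_def)
  show ?thesis unfolding q i v_def[symmetric] power_mult_distrib by (simp add: cmod_power2)
qed

definition rho1 :: "complex \<times> complex \<Rightarrow> (complex \<times> complex) \<Rightarrow>\<^sub>L real" where
  "rho1 x = blinfun_inner_right (lgrad (fst x), lgrad (snd x))"

definition rho2 :: "complex \<times> complex \<Rightarrow> (complex \<times> complex) \<Rightarrow>\<^sub>L ((complex \<times> complex) \<Rightarrow>\<^sub>L real)" where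
  "rho2 x = Blinfun (\<lambda>s. blinfun_inner_right (lhess (fst x) (fst s), lhess (snd x) (snd s)))"

lemma bounded_linear_lhess: "bounded_linear (lhess z)"
proof (rule linear_conv_bounded_linear[THEN iffD1], rule linearI)
  show "lhess z (a + b) = lhess z a + lhess z b" for a b
    by (simp add: lhess_def add_divide_distrib algebra_simps scaleR_conv_of_real)
  show "lhess z (c *\<^sub>R a) = c *\<^sub>R lhess z a" for c a
  proof -
    have 1: "c *\<^sub>R a / z = c *\<^sub>R (a / z)" "c *\<^sub>R a / z\<^sup>2 = c *\<^sub>R (a / z\<^sup>2)" by (simp_all add: scaleR_conv_of_real)
    define v v' where "v = a / z" and "v' = a / z\<^sup>2"
    show ?thesis unfolding lhess_def 1 v_def[symmetric] v'_def[symmetric]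
      by (simp add: scaleR_diff_right mult_ac)
  qed
qed

lemma rho2_apply: "blinfun_apply (rho2 x) s = blinfun_inner_right (lhess (fst x) (fst s), lhess (snd x) (snd s))"
  unfolding rho2_def
  by (subst bounded_linear_Blinfun_apply)
     (auto intro!: bounded_linear_compose[OF bounded_linear_blinfun_inner_right] bounded_linear_Pair
       bounded_linear_compose[OF bounded_linear_lhess] bounded_linear_fst bounded_linear_snd)

lemma C2_fun_log_sq: "C2_fun off_axes (\<lambda>x. log_sq x - \<epsilon>\<^sup>2) rho1 rho2"
  unfolding C2_fun_def
proof (intro conjI ballI open_off_axes)
  fix q assume "q \<in> off_axes"
  then have q: "fst q \<noteq> 0" "snd q \<noteq> 0" by (auto simp: off_axes_def)
  have f: "(fst has_derivative fst) (at q)" "(snd has_derivative snd) (at q)"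
    by (auto intro!: derivative_eq_intros)
  show "((\<lambda>x. log_sq x - \<epsilon>\<^sup>2) has_derivative blinfun_apply (rho1 q)) (at q)"
    using has_derivative_add[OF has_derivative_compose[OF f(1) has_derivative_ln_cmod_sq[OF q(1)]]
        has_derivative_compose[OF f(2) has_derivative_ln_cmod_sq[OF q(2)]], THEN has_derivative_diff, OF has_derivative_const[of "\<epsilon>\<^sup>2"]]
    unfolding log_sq_def by (rule has_derivative_eq_rhs) (auto simp: rho1_def inner_prod_def)
  have "((\<lambda>x. (lgrad (fst x), lgrad (snd x))) has_derivative (\<lambda>s. (lhess (fst q) (fst s), lhess (snd q) (snd s)))) (at q)"
    by (intro has_derivative_Pair has_derivative_compose[OF f(1) has_derivative_lgrad[OF q(1)]]
       has_derivative_compose[OF f(2) has_derivative_lgrad[OF q(2)]])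
  from bounded_linear.has_derivative[OF bounded_linear_blinfun_inner_right this]
  show "(rho1 has_derivative blinfun_apply (rho2 q)) (at q)"
    unfolding rho1_def[abs_def] by (rule has_derivative_eq_rhs) (auto simp: rho2_apply)
next
  show "continuous_on off_axes rho2"
  proof (rule continuous_on_blinfun_componentwise)
    fix i :: "complex \<times> complex"
    show "continuous_on off_axes (\<lambda>x. blinfun_apply (rho2 x) i)"
      unfolding rho2_apply lhess_def off_axes_def
      by (intro bounded_linear.continuous_on[OF bounded_linear_blinfun_inner_right] continuous_intros) auto
  qed
qed

text \<open>\<open>log_sq\<close> is strictly plurisubharmonic off the axes: its Levi form is half
  the sum of \<open>|t1 / z|\<^sup>2\<close> and \<open>|t2 / w|\<^sup>2\<close>.\<close>

lemma levi_pos_log_sq: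
  assumes "q \<in> off_axes" "log_sq q > 0"
  shows "levi_pos_at rho1 rho2 q"
  unfolding levi_pos_at_def
proof (intro conjI allI impI)
  have q: "fst q \<noteq> 0" "snd q \<noteq> 0" using assms by (auto simp: off_axes_def)
  have g: "inner (lgrad z) (ln (cmod z) *\<^sub>R z) = 2 * (ln (cmod z))\<^sup>2" if "z \<noteq> 0" for z
  proof -
    have "inner (cnj (inverse z)) z = Re (inverse z * z)" by (simp add: inner_complex_def)
    then show ?thesis using that by (simp add: lgrad_def power2_eq_square)
  qed
  \<comment> \<open>This is the radial field in logarithmic coordinates. There \<open>log_sq\<close>
    is homogeneous of degree 2, whence the factor 2 by Euler's relation.\<close>
  have "blinfun_apply (rho1 q) (ln (cmod (fst q)) *\<^sub>R fst q, ln (cmod (snd q)) *\<^sub>R snd q) = 2 * log_sq q"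
    using g[OF q(1)] g[OF q(2)] by (simp add: rho1_def log_sq_def)
  then show "rho1 q \<noteq> 0" using assms by auto
  fix t :: "complex \<times> complex" assume "t \<noteq> 0 \<and> blinfun_apply (rho1 q) t = 0 \<and> blinfun_apply (rho1 q) (cmul \<i> t) = 0"
  then have "fst t \<noteq> 0 \<or> snd t \<noteq> 0" by (auto simp: prod_eq_iff)
  then have pos: "0 < (cmod (fst t / fst q))\<^sup>2 + (cmod (snd t / snd q))\<^sup>2"
    using q by (auto simp: add_pos_nonneg add_nonneg_pos)
  have "levi_form rho2 q t = ((inner (lhess (fst q) (fst t)) (fst t) + inner (lhess (fst q) (\<i> * fst t)) (\<i> * fst t))
      + (inner (lhess (snd q) (snd t)) (snd t) + inner (lhess (snd q) (\<i> * snd t)) (\<i> * snd t))) / 4"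
    by (simp add: levi_form_def rho2_apply cmul_def inner_prod_def)
  also have "\<dots> = ((cmod (fst t / fst q))\<^sup>2 + (cmod (snd t / snd q))\<^sup>2) / 2"
    unfolding lhess_levi by simp
  finally show "0 < levi_form rho2 q t" using pos by (simp only: half_gt_zero)
qed

lemma spsc_domain_Deps:
  assumes "\<epsilon> > 0" shows "spsc_domain (Deps \<epsilon>)"
  unfolding spsc_domain_def
proof (intro conjI exI)
  show "Deps \<epsilon> \<noteq> {}" using assms by (auto simp: Deps_def intro!: exI[of _ 1])
  show "\<forall>q\<in>frontier (Deps \<epsilon>). levi_pos_at rho1 rho2 q"
    using assms by (auto simp: frontier_Deps intro!: levi_pos_log_sq)
  show "C2_fun off_axes (\<lambda>x. log_sq x - \<epsilon>\<^sup>2) rho1 rho2" by (rule C2_fun_log_sq)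
  show "frontier (Deps \<epsilon>) \<subseteq> off_axes" using assms by (auto simp: frontier_Deps)
  show "Deps \<epsilon> \<inter> off_axes = {q \<in> off_axes. log_sq q - \<epsilon>\<^sup>2 < 0}" by (auto simp: Deps_eq)
qed (use assms in \<open>auto intro: open_Deps connected_Deps\<close>)

lemma spsc_hypersurface_Deps:
  assumes "\<epsilon> > 0" shows "spsc_hypersurface (frontier (Deps \<epsilon>))"
  unfolding spsc_hypersurface_def
proof (intro ballI exI conjI)
  show "C2_fun off_axes (\<lambda>x. log_sq x - \<epsilon>\<^sup>2) rho1 rho2" by (rule C2_fun_log_sq)
qed (use assms in \<open>auto simp: frontier_Deps intro!: levi_pos_log_sq\<close>)

section \<open>Absence of umbilical points\<close>

lemma has_derivative_Ln_quotient:
  fixes f :: "complex \<times> complex \<Rightarrow> complex"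
  assumes "(f has_derivative (\<lambda>v. a * fst v + b * snd v)) (at x)" "z0 \<noteq> 0" "f x / z0 \<notin> \<real>\<^sub>\<le>\<^sub>0"
  shows "((\<lambda>x. Ln (f x / z0)) has_derivative (\<lambda>v. a / f x * fst v + b / f x * snd v)) (at x)"
proof -
  have "f x \<noteq> 0" using assms by auto
  have "((\<lambda>t. Ln (t / z0)) has_field_derivative inverse (f x / z0) * (1 / z0)) (at (f x))"
    using assms by (auto intro!: derivative_eq_intros)
  then have "((\<lambda>t. Ln (t / z0)) has_derivative (\<lambda>h. h / f x)) (at (f x))"
    unfolding has_field_derivative_def using assms(2) \<open>f x \<noteq> 0\<close>
    by (auto elim!: has_derivative_eq_rhs simp: field_simps)
  from has_derivative_compose[OF assms(1) this]
  show ?thesis by (simp add: add_divide_distrib)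
qed

lemma complex_linear_components:
  assumes "(f has_derivative L) (at x)" "\<And>c v. L (cmul c v) = cmul c (L v)"
  shows "L v = (fst (L (1, 0)) * fst v + fst (L (0, 1)) * snd v, snd (L (1, 0)) * fst v + snd (L (0, 1)) * snd v)"
proof -
  have "v = cmul (fst v) (1, 0) + cmul (snd v) (0, 1)" by (simp add: cmul_def)
  then have "L v = L (cmul (fst v) (1, 0)) + L (cmul (snd v) (0, 1))"
    using linear_add[OF has_derivative_linear[OF assms(1)]] by metis
  then show ?thesis unfolding assms(2) by (simp add: cmul_def mult.commute)
qed

text \<open>The quotient lies within distance 1 of the point 1, hence in the right half plane, away
  from the branch cut of \<open>Ln\<close>.\<close>

lemma not_nonpos_Reals_near_one:
  assumes "t \<in> ball z0 (cmod z0)" "z0 \<noteq> 0" shows "t / z0 \<notin> \<real>\<^sub>\<le>\<^sub>0"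
proof -
  have "cmod (1 - t / z0) * cmod z0 = cmod (z0 - t)"
    using assms(2) by (simp add: left_diff_distrib flip: norm_mult)
  then have "cmod (1 - t / z0) * cmod z0 < 1 * cmod z0" using assms by (simp add: dist_norm)
  then have "cmod (1 - t / z0) < 1" by (rule mult_right_less_imp_less) simp
  then have "Re (1 - t / z0) < 1" using complex_Re_le_cmod le_less_trans by blast
  then show ?thesis by (auto simp: complex_nonpos_Reals_iff)
qed

text \<open>The inverse of a normalizing map at an umbilical point yields an instance of
  \<open>normalized_tube\<close>. The vanishing determinant found there contradicts the
  invertibility of the derivative.\<close>

lemma frontier_Deps_not_umbilical:
  assumes \<epsilon>: "\<epsilon> > 0" and p: "p \<in> frontier (Deps \<epsilon>)"
  shows "\<not> umbilical (frontier (Deps \<epsilon>)) p"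
proof
  let ?M = "frontier (Deps \<epsilon>)"
  assume "umbilical ?M p"
  then obtain U \<Phi> and N :: "nat \<Rightarrow> nat \<Rightarrow> real \<Rightarrow> complex" where
    pU: "p \<in> U" and bi: "biholo U \<Phi>" and \<Phi>p: "\<Phi> p = (0, 0)" and
    N0: "\<forall>k l u. (k < 2 \<or> l < 2) \<longrightarrow> N k l u = 0" and
    Nherm: "\<forall>k l u. N l k u = cnj (N k l u)" and
    N2: "\<forall>u. N 2 2 u = 0 \<and> N 2 3 u = 0 \<and> N 3 3 u = 0" and
    sm: "\<forall>z w. (z, w) \<in> \<Phi> ` U \<longrightarrow>
          (\<lambda>(k, l). norm (N k l (Re w) * z ^ k * cnj z ^ l)) summable_on UNIV" and
    im: "\<Phi> ` (?M \<inter> U) = {(z, w). (z, w) \<in> \<Phi> ` U \<and>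
          Im w = (cmod z)\<^sup>2 + Re (infsum (\<lambda>(k, l). N k l (Re w) * z ^ k * cnj z ^ l) UNIV)}" and
    N24: "N 2 4 0 = 0"
    unfolding umbilical_def by (elim exE conjE) (rule that; assumption)
  define V where "V = \<Phi> ` U"
  define \<Psi> where "\<Psi> = the_inv_into U \<Phi>"
  have oU: "open U" and oV: "open V" and inj: "inj_on \<Phi> U" and h\<Phi>: "holo2_on U \<Phi>" and h\<Psi>: "holo2_on V \<Psi>"
    using bi by (auto simp: biholo_def V_def \<Psi>_def)
  have \<Psi>\<Phi>: "\<Psi> (\<Phi> x) = x" if "x \<in> U" for x
    unfolding \<Psi>_def using inj that by (rule the_inv_into_f_f)
  have V0: "(0, 0) \<in> V" using pU \<Phi>p by (force simp: V_def)
  have \<Psi>0: "\<Psi> (0, 0) = p" using \<Psi>\<Phi>[OF pU] \<Phi>p by simp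
  obtain z0 w0 where pzw: "p = (z0, w0)" by (cases p)
  have p': "p \<in> off_axes" "log_sq p = \<epsilon>\<^sup>2" using p \<epsilon> by (auto simp: frontier_Deps)
  have nz: "z0 \<noteq> 0" "w0 \<noteq> 0" using p' pzw by (auto simp: off_axes_def)
  have "continuous_on V \<Psi>"
    using h\<Psi> unfolding holo2_on_def
    by (intro continuous_at_imp_continuous_on ballI) (meson has_derivative_continuous)
  then have oW: "open (V \<inter> \<Psi> -` (ball z0 (cmod z0) \<times> ball w0 (cmod w0)))" (is "open ?W")
    using oV by (intro continuous_open_preimage open_Times open_ball)
  have "(0, 0) \<in> ?W" using V0 \<Psi>0 pzw nz by simp
  then obtain e where e: "e > 0" "ball (0, 0) e \<subseteq> ?W" using oW open_contains_ball by blast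
  define r where "r = e / 2"
  define s where "s = r / 2"
  have rs: "0 < s" "s \<le> r" "0 < r" "s < r" using e by (auto simp: r_def s_def)
  have W: "(z, w) \<in> ?W" if "norm z < r" "norm w < r" for z w
  proof -
    have "norm (z, w) \<le> norm z + norm w" by (rule norm_Pair_le)
    then have "(z, w) \<in> ball (0, 0) e" using that by (simp add: r_def dist_norm norm_Pair)
    then show ?thesis using e by blast
  qed
  \<comment> \<open>Division by \<open>z0\<close> and \<open>w0\<close> moves the base point to 1,
    where the principal logarithm is holomorphic and zero.\<close>
  define X Y where "X = (\<lambda>x. Ln (fst (\<Psi> x) / z0))" and "Y = (\<lambda>x. Ln (snd (\<Psi> x) / w0))"
  have der: "\<exists>L. (\<Psi> has_derivative L) (at x) \<and> (\<forall>v. L v = (fst (L (1, 0)) * fst v + fst (L (0, 1)) * snd v,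
        snd (L (1, 0)) * fst v + snd (L (0, 1)) * snd v)) \<and>
      (X has_derivative (\<lambda>v. fst (L (1, 0)) / fst (\<Psi> x) * fst v + fst (L (0, 1)) / fst (\<Psi> x) * snd v)) (at x) \<and>
      (Y has_derivative (\<lambda>v. snd (L (1, 0)) / snd (\<Psi> x) * fst v + snd (L (0, 1)) / snd (\<Psi> x) * snd v)) (at x)"
    if x: "x \<in> ?W" for x
  proof -
    obtain L where L: "(\<Psi> has_derivative L) (at x)" "\<And>c v. L (cmul c v) = cmul c (L v)"
      using h\<Psi> x unfolding holo2_on_def by blast
    note Lv = complex_linear_components[OF L]
    have 1: "((\<lambda>x. fst (\<Psi> x)) has_derivative (\<lambda>v. fst (L (1, 0)) * fst v + fst (L (0, 1)) * snd v)) (at x)"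
    proof (rule has_derivative_eq_rhs[OF has_derivative_fst[OF L(1)]], rule ext)
      show "fst (L v) = fst (L (1, 0)) * fst v + fst (L (0, 1)) * snd v" for v
        using arg_cong[OF Lv[of v], of fst] by (simp only: fst_conv)
    qed
    have 2: "((\<lambda>x. snd (\<Psi> x)) has_derivative (\<lambda>v. snd (L (1, 0)) * fst v + snd (L (0, 1)) * snd v)) (at x)"
    proof (rule has_derivative_eq_rhs[OF has_derivative_snd[OF L(1)]], rule ext)
      show "snd (L v) = snd (L (1, 0)) * fst v + snd (L (0, 1)) * snd v" for v
        using arg_cong[OF Lv[of v], of snd] by (simp only: snd_conv)
    qed
    have 3: "fst (\<Psi> x) / z0 \<notin> \<real>\<^sub>\<le>\<^sub>0" "snd (\<Psi> x) / w0 \<notin> \<real>\<^sub>\<le>\<^sub>0"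
      by (rule not_nonpos_Reals_near_one; use x nz in \<open>simp add: mem_Times_iff\<close>)+
    show ?thesis unfolding X_def Y_def
      by (intro exI[of _ L] conjI allI L(1) Lv has_derivative_Ln_quotient[OF 1 nz(1) 3(1)]
          has_derivative_Ln_quotient[OF 2 nz(2) 3(2)])
  qed
  interpret normalized_tube r s "ln (cmod z0)" "ln (cmod w0)" \<epsilon> X Y N
  proof
    show "0 < s" "s \<le> r" "0 < \<epsilon>" using rs \<epsilon> by auto
    show "(ln (cmod z0))\<^sup>2 + (ln (cmod w0))\<^sup>2 = \<epsilon>\<^sup>2" using p' by (simp add: log_sq_def pzw)
    show "hol2 r X" "hol2 r Y" unfolding hol2_def using der[OF W] by blast+
    show "X (0, 0) = 0" "Y (0, 0) = 0" using nz by (auto simp: X_def Y_def \<Psi>0 pzw)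
    show "N k l u = 0" if "k < 2 \<or> l < 2" for k l u using N0 that by blast
    show "N l k u = cnj (N k l u)" for k l u by (rule Nherm[rule_format])
    show "N 2 2 0 = 0" "N 2 3 0 = 0" "N 2 4 0 = 0" using N2 N24 by auto
    show "dsummable s (\<lambda>k l. N k l u)" if u: "\<bar>u\<bar> < r" for u
    proof -
      have "(complex_of_real s, complex_of_real u) \<in> \<Phi> ` U"
        using W[of "of_real s" "of_real u"] rs u by (simp add: V_def)
      from sm[rule_format, OF this] show ?thesis
        unfolding dsummable_def using rs by (simp add: norm_mult norm_power)
    qed
    show "(Re (X (z, w)) + ln (cmod z0))\<^sup>2 + (Re (Y (z, w)) + ln (cmod w0))\<^sup>2 = \<epsilon>\<^sup>2"
      if z: "norm z < s" "norm w < r" and eq: "Im w = (norm z)\<^sup>2 + Re (dser (\<lambda>k l. N k l (Re w)) z (cnj z))" for z w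
    proof -
      have "(z, w) \<in> V" using W[of z w] z rs by simp
      then have "(z, w) \<in> \<Phi> ` (?M \<inter> U)" using eq unfolding im dser_def by (simp add: V_def)
      then obtain m where m: "m \<in> ?M" "m \<in> U" "\<Phi> m = (z, w)" by auto
      have \<Psi>m: "\<Psi> (z, w) = m" using \<Psi>\<Phi>[OF m(2)] m(3) by simp
      have "m \<in> off_axes" "log_sq m = \<epsilon>\<^sup>2" using m(1) \<epsilon> by (auto simp: frontier_Deps)
      \<comment> \<open>The shifts by \<open>ln (cmod z0)\<close> and \<open>ln (cmod w0)\<close>
        restore the logarithms of the moduli of \<open>m\<close>, so the equation is that of the
        level set of \<open>log_sq\<close>.\<close>
      then show ?thesis using nz
        by (simp add: X_def Y_def \<Psi>m off_axes_def log_sq_def norm_divide ln_div)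
    qed
  qed
  obtain L where L: "(\<Psi> has_derivative L) (at (0, 0))"
    "\<forall>v. L v = (fst (L (1, 0)) * fst v + fst (L (0, 1)) * snd v, snd (L (1, 0)) * fst v + snd (L (0, 1)) * snd v)"
    "(X has_derivative (\<lambda>v. fst (L (1, 0)) / z0 * fst v + fst (L (0, 1)) / z0 * snd v)) (at (0, 0))"
    "(Y has_derivative (\<lambda>v. snd (L (1, 0)) / w0 * fst v + snd (L (0, 1)) / w0 * snd v)) (at (0, 0))"
  proof -
    have "(0, 0) \<in> ?W" using W[of 0 0] rs by simp
    from der[OF this, unfolded \<Psi>0 pzw fst_conv snd_conv] show thesis by (elim exE conjE) (rule that; assumption)
  qed
  \<comment> \<open>The logarithms contribute only the nonzero factors \<open>1 / z0\<close> and
    \<open>1 / w0\<close>, so the determinant of the derivative of \<open>\<Psi>\<close> vanishes as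
    well.\<close>
  from det_eq_zero[OF L(3,4)] have det: "fst (L (1, 0)) * snd (L (0, 1)) = fst (L (0, 1)) * snd (L (1, 0))"
    using nz by (simp add: field_simps)
  obtain L' where L': "(\<Phi> has_derivative L') (at p)" using h\<Phi> pU unfolding holo2_on_def by blast
  have "((\<lambda>x. \<Psi> (\<Phi> x)) has_derivative (\<lambda>v. L (L' v))) (at p)"
    by (rule has_derivative_compose[OF L']) (use L(1) \<Phi>p in simp)
  then have "((\<lambda>x. x) has_derivative (\<lambda>v. L (L' v))) (at p)"
    by (rule has_derivative_transform_within_open[OF _ oU pU]) (rule \<Psi>\<Phi>)
  then have id: "L (L' v) = v" for v
    using has_derivative_unique[OF _ has_derivative_ident] by metis
  \<comment> \<open>The entries of the matrix equation \<open>L L' = 1\<close>; a singular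
    \<open>L\<close> cannot satisfy it.\<close>
  have "fst (L (1, 0)) * fst (L' (1, 0)) + fst (L (0, 1)) * snd (L' (1, 0)) = 1"
       "snd (L (1, 0)) * fst (L' (1, 0)) + snd (L (0, 1)) * snd (L' (1, 0)) = 0"
       "fst (L (1, 0)) * fst (L' (0, 1)) + fst (L (0, 1)) * snd (L' (0, 1)) = 0"
       "snd (L (1, 0)) * fst (L' (0, 1)) + snd (L (0, 1)) * snd (L' (0, 1)) = 1"
    using L(2)[rule_format, of "L' (1, 0)", unfolded id] L(2)[rule_format, of "L' (0, 1)", unfolded id] by (simp_all only: prod.inject)
  with det have "(1::complex) = 0" by algebra
  then show False by simp
qed

theorem theorem1p1:
  fixes \<epsilon> :: real
  assumes "\<epsilon> > 0"
  shows "bounded (Deps \<epsilon>) \<and> spsc_domain (Deps \<epsilon>) \<and>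
         compact (frontier (Deps \<epsilon>)) \<and> spsc_hypersurface (frontier (Deps \<epsilon>)) \<and>
         (\<forall>p \<in> frontier (Deps \<epsilon>). \<not> umbilical (frontier (Deps \<epsilon>)) p)"
  using assms bounded_Deps spsc_domain_Deps spsc_hypersurface_Deps frontier_Deps_not_umbilical
    compact_frontier_bounded by blast

end
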